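(* Let $(M^{2m},J,g)$ be a standard Kähler manifold with curvature tensor $R$, and let $(T^{*}M,{}^{BS}g)$ be its cotangent bundle equipped with the Berger-type deformed Sasaki metric with constant $\delta$. A curve $C=(\gamma(t),\vartheta(t))$ on $T^{*}M$ is a geodesic of $(T^{*}M,{}^{BS}g)$ if and only if $$\begin{cases}\gamma''=\mathcal{R}(\widetilde{\vartheta'},\widetilde{\vartheta})\gamma',\\[2pt] \vartheta''=2\delta^{2}g^{-1}(\vartheta',\vartheta J)\Big(\dfrac{\delta^{2}}{\lambda}g^{-1}(\vartheta',\vartheta)\,\vartheta J-\vartheta'J\Big),\end{cases}$$ where $\mathcal{R}(\widetilde{\vartheta'},\widetilde{\vartheta})=R(\widetilde{\vartheta'},\widetilde{\vartheta})+\delta^{2}g^{-1}(\vartheta',\vartheta J)R(\widetilde{\vartheta},J\widetilde{\vartheta})$ and $\lambda=1+\delta^{2}g^{-1}(\vartheta,\vartheta)$.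
   Context: All objects are smooth. A standard Kähler manifold $(M^{2m},J,g)$ is a $2m$-dimensional manifold with an almost complex structure $J$ ($J^2=-I$) and a Riemannian metric $g$ with $g(JX,JY)=g(X,Y)$ such that $\nabla J=0$, where $\nabla$ is the Levi-Civita connection of $g$. The curvature convention is $R(X,Y)Z=\nabla_X\nabla_YZ-\nabla_Y\nabla_XZ-\nabla_{[X,Y]}Z$. For a covector $\omega$, $\widetilde\omega$ is the vector with $g(\widetilde\omega,X)=\omega(X)$ for all $X$; $g^{-1}(\omega,\theta)=g(\widetilde\omega,\widetilde\theta)$; $\omega J$ is the covector $(\omega J)(X)=\omega(JX)$. In the coordinates $(x^i,p_i)$ on $T^{*}M$ induced by coordinates $(x^i)$ on $M$, with Christoffel symbols $\Gamma^k_{ij}$ of $g$, the horizontal lift of $X=X^i\partial_{x^i}$ is ${}^{H}X=X^{i}\partial_{x^i}+p_{h}\Gamma^{h}_{ij}X^{j}\partial_{p_i}$ and the vertical lift of $\omega=\omega_idx^i$ is ${}^{V}\omega=\omega_i\partial_{p_i}$. The Berger-type deformed Sasaki metric ${}^{BS}g$ on $T^{*}M$, with real constant $\delta$, is the Riemannian metric defined at $(x,p)$ by ${}^{BS}g({}^{H}X,{}^{H}Y)=g(X,Y)$, ${}^{BS}g({}^{H}X,{}^{V}\theta)=0$, ${}^{BS}g({}^{V}\omega,{}^{V}\theta)=g^{-1}(\omega,\theta)+\delta^{2}g^{-1}(\omega,pJ)\,g^{-1}(\theta,pJ)$. A curve $C=(\gamma(t),\vartheta(t))$, $t$ in an open interval,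 on $T^{*}M$ consists of a curve $\gamma$ on $M$ and a covector field $\vartheta$ along $\gamma$. Notation: $\gamma'=\frac{d\gamma}{dt}$, $\gamma''=\nabla_{\gamma'}\gamma'$, $\vartheta'=\nabla_{\gamma'}\vartheta$, $\vartheta''=\nabla_{\gamma'}\vartheta'$ (covariant derivatives along $\gamma$). *)

theory Defs
  imports "HOL-Analysis.Analysis"
begin

section \<open>Smooth maps and smooth manifolds\<close>

text \<open>
  Only used on open sets of Euclidean spaces, where existence and continuity of all iterated
  directional derivatives up to order \<open>n\<close> is the usual notion of class \<open>C\<^sup>n\<close>.
\<close>

primrec ck_on ::
  "nat \<Rightarrow> ('a::euclidean_space \<Rightarrow> 'b::real_normed_vector) \<Rightarrow> 'a set \<Rightarrow> bool" where
  "ck_on 0 f S \<longleftrightarrow> continuous_on S f"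
| "ck_on (Suc n) f S \<longleftrightarrow> (\<forall>x\<in>S. f differentiable (at x)) \<and>
     (\<forall>v. ck_on n (\<lambda>x. frechet_derivative f (at x) v) S)"

definition smooth_on ::
  "('a::euclidean_space \<Rightarrow> 'b::real_normed_vector) \<Rightarrow> 'a set \<Rightarrow> bool" where
  "smooth_on f S \<longleftrightarrow> (\<forall>n. ck_on n f S)"

text \<open>
  A manifold is given by an atlas \<open>A\<close>, a family of charts \<open>A i = (U\<^sub>i, \<phi>\<^sub>i)\<close> indexed by a type.
  Its points are those of \<open>\<Union>\<^sub>i U\<^sub>i\<close>, and its topology is the one induced by the charts.
  Charts with empty domain are harmless, so indexing by a whole type is no restriction.
\<close>

type_synonym ('i, 'a, 'e) atlas = "'i \<Rightarrow> 'a set \<times> ('a \<Rightarrow> 'e)"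

definition chart_dom :: "('i, 'a, 'e) atlas \<Rightarrow> 'i \<Rightarrow> 'a set" where
  "chart_dom A i = fst (A i)"

definition chart_map :: "('i, 'a, 'e) atlas \<Rightarrow> 'i \<Rightarrow> 'a \<Rightarrow> 'e" where
  "chart_map A i = snd (A i)"

definition chart_im :: "('i, 'a, 'e) atlas \<Rightarrow> 'i \<Rightarrow> 'e set" where
  "chart_im A i = chart_map A i ` chart_dom A i"

definition points :: "('i, 'a, 'e) atlas \<Rightarrow> 'a set" where
  "points A = (\<Union>i. chart_dom A i)"

definition transition :: "('i, 'a, 'e) atlas \<Rightarrow> 'i \<Rightarrow> 'i \<Rightarrow> 'e \<Rightarrow> 'e" where
  "transition A i j = chart_map A j \<circ> inv_into (chart_dom A i) (chart_map A i)"

definition transition_deriv ::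
  "('i, 'a, 'e::euclidean_space) atlas \<Rightarrow> 'i \<Rightarrow> 'i \<Rightarrow> 'a \<Rightarrow> 'e \<Rightarrow> 'e" where
  "transition_deriv A i j x = frechet_derivative (transition A i j) (at (chart_map A i x))"

definition smooth_atlas :: "('i, 'a, 'e::euclidean_space) atlas \<Rightarrow> bool" where
  "smooth_atlas A \<longleftrightarrow>
     (\<forall>i. inj_on (chart_map A i) (chart_dom A i)) \<and>
     (\<forall>i j. open (chart_map A i ` (chart_dom A i \<inter> chart_dom A j)) \<and>
            smooth_on (transition A i j) (chart_map A i ` (chart_dom A i \<inter> chart_dom A j)))"

definition manifold_topology :: "('i, 'a, 'e::euclidean_space) atlas \<Rightarrow> 'a topology" where
  "manifold_topology A =
     topology (\<lambda>W. W \<subseteq> points A \<and> (\<forall>i. open (chart_map A i ` (chart_dom A i \<inter> W))))"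

definition smooth_manifold :: "('i, 'a, 'e::euclidean_space) atlas \<Rightarrow> bool" where
  "smooth_manifold A \<longleftrightarrow> smooth_atlas A \<and>
     Hausdorff_space (manifold_topology A) \<and> second_countable (manifold_topology A)"

lemma openin_manifold_topology:
  assumes "smooth_atlas A"
  shows "openin (manifold_topology A) W \<longleftrightarrow>
    W \<subseteq> points A \<and> (\<forall>i. open (chart_map A i ` (chart_dom A i \<inter> W)))"
proof -
  let ?P = "\<lambda>W. W \<subseteq> points A \<and> (\<forall>i. open (chart_map A i ` (chart_dom A i \<inter> W)))"
  have inj: "inj_on (chart_map A i) (chart_dom A i)" for i
    using assms by (auto simp: smooth_atlas_def)
  have "?P (S \<inter> T)" if "?P S" "?P T" for S T
  proof -
    have "chart_map A i ` (chart_dom A i \<inter> (S \<inter> T)) =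
      chart_map A i ` (chart_dom A i \<inter> S) \<inter> chart_map A i ` (chart_dom A i \<inter> T)" for i
      using inj[of i] by (auto simp: inj_on_def)
    with that show ?thesis by (auto intro: open_Int)
  qed
  moreover have "?P (\<Union>\<K>)" if "\<forall>K\<in>\<K>. ?P K" for \<K>
  proof -
    have "chart_map A i ` (chart_dom A i \<inter> \<Union>\<K>) =
      (\<Union>K\<in>\<K>. chart_map A i ` (chart_dom A i \<inter> K))" for i
      by auto
    with that show ?thesis by (auto intro!: open_UN)
  qed
  ultimately have "istopology ?P"
    unfolding istopology_def by meson
  then show ?thesis
    unfolding manifold_topology_def by (simp add: topology_inverse')
qed

section \<open>Tensor fields\<close>

text \<open>
  A tensor field is the family of its components in the charts, subject to the transformation
  law under change of charts; components are functions of the coordinates, defined on the image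
  of the chart. Likewise a tangent vector or a covector at a point \<open>x\<close> is the family of its
  components. The components \<open>(\<omega>\<^sub>1, \<dots>, \<omega>\<^sub>n)\<close> of a covector are stored as the element \<open>\<omega>\<close>
  of the model space \<open>'e\<close> for which the covector is \<open>v \<mapsto> \<omega> \<bullet> v\<close>;
  \<open>covec\<close> produces this element from a linear functional.
\<close>

definition covec :: "('e::euclidean_space \<Rightarrow> real) \<Rightarrow> 'e" where
  "covec f = (\<Sum>b\<in>Basis. f b *\<^sub>R b)"

lemma covec_inner: "linear f \<Longrightarrow> covec f \<bullet> v = f v"
proof -
  assume f: "linear f"
  have "f v = f (\<Sum>b\<in>Basis. (v \<bullet> b) *\<^sub>R b)"
    by (simp add: euclidean_representation)
  also have "\<dots> = (\<Sum>b\<in>Basis. (v \<bullet> b) * f b)"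
    by (simp add: linear_sum[OF f] linear_scale[OF f])
  also have "\<dots> = covec f \<bullet> v"
    by (simp add: covec_def inner_sum_left inner_commute[of v] mult.commute)
  finally show ?thesis by simp
qed

type_synonym ('i, 'e) metric = "'i \<Rightarrow> 'e \<Rightarrow> 'e \<Rightarrow> 'e \<Rightarrow> real"

definition riemannian_metric ::
  "('i, 'a, 'e::euclidean_space) atlas \<Rightarrow> ('i, 'e) metric \<Rightarrow> bool" where
  "riemannian_metric A g \<longleftrightarrow>
     (\<forall>i. (\<forall>x\<in>chart_im A i. bilinear (g i x) \<and> (\<forall>u v. g i x u v = g i x v u) \<and>
             (\<forall>u. u \<noteq> 0 \<longrightarrow> g i x u u > 0)) \<and>
          (\<forall>u v. smooth_on (\<lambda>x. g i x u v) (chart_im A i))) \<and>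
     (\<forall>i j. \<forall>x\<in>chart_dom A i \<inter> chart_dom A j. \<forall>u v.
        g i (chart_map A i x) u v =
        g j (chart_map A j x) (transition_deriv A i j x u) (transition_deriv A i j x v))"

definition almost_complex_structure ::
  "('i, 'a, 'e::euclidean_space) atlas \<Rightarrow> ('i \<Rightarrow> 'e \<Rightarrow> 'e \<Rightarrow> 'e) \<Rightarrow> bool" where
  "almost_complex_structure A J \<longleftrightarrow>
     (\<forall>i. (\<forall>x\<in>chart_im A i. linear (J i x) \<and> (\<forall>u. J i x (J i x u) = - u)) \<and>
          (\<forall>u. smooth_on (\<lambda>x. J i x u) (chart_im A i))) \<and>
     (\<forall>i j. \<forall>x\<in>chart_dom A i \<inter> chart_dom A j. \<forall>u.
        transition_deriv A i j x (J i (chart_map A i x) u) =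
        J j (chart_map A j x) (transition_deriv A i j x u))"

definition covector_at ::
  "('i, 'a, 'e::euclidean_space) atlas \<Rightarrow> 'a \<Rightarrow> ('i \<Rightarrow> 'e) \<Rightarrow> bool" where
  "covector_at A x \<omega> \<longleftrightarrow>
     (\<forall>i j. x \<in> chart_dom A i \<longrightarrow> x \<in> chart_dom A j \<longrightarrow>
        (\<forall>v. \<omega> i \<bullet> v = \<omega> j \<bullet> transition_deriv A i j x v)) \<and>
     (\<forall>i. x \<notin> chart_dom A i \<longrightarrow> \<omega> i = 0)"

text \<open>
  Pointwise musical isomorphism and inverse metric for an inner product \<open>G\<close> on the model space.
\<close>

definition sharp :: "('e \<Rightarrow> 'e \<Rightarrow> real) \<Rightarrow> 'e::euclidean_space \<Rightarrow> 'e" where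
  "sharp G \<omega> = (THE w. \<forall>v. G w v = \<omega> \<bullet> v)"

definition cometric :: "('e \<Rightarrow> 'e \<Rightarrow> real) \<Rightarrow> 'e::euclidean_space \<Rightarrow> 'e \<Rightarrow> real" where
  "cometric G \<omega> \<theta> = G (sharp G \<omega>) (sharp G \<theta>)"

lemma sharp_eqI:
  assumes "bilinear G" "\<And>u. u \<noteq> 0 \<Longrightarrow> G u u > 0" "\<And>v. G w v = \<omega> \<bullet> v"
  shows "sharp G \<omega> = w"
  unfolding sharp_def
proof (rule the_equality)
  fix w' assume w': "\<forall>v. G w' v = \<omega> \<bullet> v"
  have "G (w' - w) (w' - w) = 0"
    using w' assms(3) by (simp add: bilinear_lsub[OF assms(1)])
  then show "w' = w"
    using assms(2)[of "w' - w"] by force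
qed (use assms(3) in simp)

section \<open>Levi-Civita connection, curvature and geodesics\<close>

text \<open>
  In what follows \<open>g\<close> is the coordinate expression of a metric in one chart and vector fields are
  written in coordinates.  The value \<open>christoffel g x u v\<close> is the vector with components
  \<open>\<Gamma>\<^sup>k\<^sub>i\<^sub>j u\<^sup>i v\<^sup>j\<close>, where \<open>\<Gamma>\<^sup>k\<^sub>i\<^sub>j = \<onehalf> g\<^sup>k\<^sup>l (\<partial>\<^sub>i g\<^sub>j\<^sub>l + \<partial>\<^sub>j g\<^sub>i\<^sub>l - \<partial>\<^sub>l g\<^sub>i\<^sub>j)\<close>.
\<close>

definition christoffel ::
  "('e \<Rightarrow> 'e \<Rightarrow> 'e \<Rightarrow> real) \<Rightarrow> 'e \<Rightarrow> 'e \<Rightarrow> 'e \<Rightarrow> 'e::euclidean_space" where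
  "christoffel g x u v = sharp (g x) (covec (\<lambda>w.
     (frechet_derivative (\<lambda>y. g y v w) (at x) u
      + frechet_derivative (\<lambda>y. g y u w) (at x) v
      - frechet_derivative (\<lambda>y. g y u v) (at x) w) / 2))"

definition nabla ::
  "('e \<Rightarrow> 'e \<Rightarrow> 'e \<Rightarrow> real) \<Rightarrow> ('e \<Rightarrow> 'e) \<Rightarrow> ('e \<Rightarrow> 'e) \<Rightarrow> 'e \<Rightarrow> 'e::euclidean_space" where
  "nabla g X Y x = frechet_derivative Y (at x) (X x) + christoffel g x (X x) (Y x)"

definition lie_bracket :: "('e \<Rightarrow> 'e) \<Rightarrow> ('e \<Rightarrow> 'e) \<Rightarrow> 'e \<Rightarrow> 'e::euclidean_space" where
  "lie_bracket X Y x = frechet_derivative Y (at x) (X x) - frechet_derivative X (at x) (Y x)"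

definition curvature_field ::
  "('e \<Rightarrow> 'e \<Rightarrow> 'e \<Rightarrow> real) \<Rightarrow> ('e \<Rightarrow> 'e) \<Rightarrow> ('e \<Rightarrow> 'e) \<Rightarrow> ('e \<Rightarrow> 'e) \<Rightarrow> 'e \<Rightarrow> 'e::euclidean_space"
  where
  "curvature_field g X Y Z x =
     nabla g X (nabla g Y Z) x - nabla g Y (nabla g X Z) x - nabla g (lie_bracket X Y) Z x"

text \<open>
  By tensoriality, the curvature on tangent vectors may be computed with any extensions to vector
  fields; those with constant coordinates are used.
\<close>

definition curvature ::
  "('e \<Rightarrow> 'e \<Rightarrow> 'e \<Rightarrow> real) \<Rightarrow> 'e \<Rightarrow> 'e \<Rightarrow> 'e \<Rightarrow> 'e \<Rightarrow> 'e::euclidean_space" where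
  "curvature g x u v w = curvature_field g (\<lambda>_. u) (\<lambda>_. v) (\<lambda>_. w) x"

definition smooth_curve ::
  "('i, 'a, 'e::euclidean_space) atlas \<Rightarrow> real set \<Rightarrow> (real \<Rightarrow> 'a) \<Rightarrow> bool" where
  "smooth_curve A I c \<longleftrightarrow> c ` I \<subseteq> points A \<and>
     (\<forall>i. open {t\<in>I. c t \<in> chart_dom A i} \<and>
          smooth_on (\<lambda>t. chart_map A i (c t)) {t\<in>I. c t \<in> chart_dom A i})"

text \<open>
  Vector and covector fields along a curve \<open>c\<close> are functions of the parameter \<open>t\<close> and the chart
  index \<open>i\<close>; their values are meaningful where \<open>c t\<close> lies in the domain of chart \<open>i\<close>.
  In coordinates \<open>(\<nabla>\<^bsub>c'\<^esub>\<theta>)\<^sub>i = \<theta>\<^sub>i' - \<theta>\<^sub>h \<Gamma>\<^sup>h\<^sub>i\<^sub>j (c\<^sup>j)'\<close>.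
\<close>

definition velocity ::
  "('i, 'a, 'e::euclidean_space) atlas \<Rightarrow> (real \<Rightarrow> 'a) \<Rightarrow> real \<Rightarrow> 'i \<Rightarrow> 'e" where
  "velocity A c t i = vector_derivative (\<lambda>s. chart_map A i (c s)) (at t)"

definition covd_vec ::
  "('i, 'a, 'e::euclidean_space) atlas \<Rightarrow> ('i, 'e) metric \<Rightarrow> (real \<Rightarrow> 'a) \<Rightarrow>
   (real \<Rightarrow> 'i \<Rightarrow> 'e) \<Rightarrow> real \<Rightarrow> 'i \<Rightarrow> 'e" where
  "covd_vec A g c X t i = vector_derivative (\<lambda>s. X s i) (at t)
     + christoffel (g i) (chart_map A i (c t)) (velocity A c t i) (X t i)"

definition covd_covec ::
  "('i, 'a, 'e::euclidean_space) atlas \<Rightarrow> ('i, 'e) metric \<Rightarrow> (real \<Rightarrow> 'a) \<Rightarrow>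
   (real \<Rightarrow> 'i \<Rightarrow> 'e) \<Rightarrow> real \<Rightarrow> 'i \<Rightarrow> 'e" where
  "covd_covec A g c \<theta> t i = vector_derivative (\<lambda>s. \<theta> s i) (at t)
     - covec (\<lambda>v. \<theta> t i \<bullet> christoffel (g i) (chart_map A i (c t)) (velocity A c t i) v)"

definition geodesic ::
  "('i, 'a, 'e::euclidean_space) atlas \<Rightarrow> ('i, 'e) metric \<Rightarrow> real set \<Rightarrow> (real \<Rightarrow> 'a) \<Rightarrow> bool" where
  "geodesic A g I c \<longleftrightarrow> smooth_curve A I c \<and>
     (\<forall>t\<in>I. \<forall>i. c t \<in> chart_dom A i \<longrightarrow> covd_vec A g c (velocity A c) t i = 0)"

section \<open>Kaehler manifolds\<close>

text \<open>
  The condition \<open>\<nabla>J = 0\<close> is \<open>\<nabla>\<^sub>X(JY) = J(\<nabla>\<^sub>X Y)\<close> for vector fields defined on a chart.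
\<close>

definition standard_kaehler ::
  "('i, 'a, 'e::euclidean_space) atlas \<Rightarrow> ('i \<Rightarrow> 'e \<Rightarrow> 'e \<Rightarrow> 'e) \<Rightarrow> ('i, 'e) metric \<Rightarrow> bool" where
  "standard_kaehler A J g \<longleftrightarrow>
     smooth_manifold A \<and> almost_complex_structure A J \<and> riemannian_metric A g \<and>
     (\<forall>i. \<forall>x\<in>chart_im A i. \<forall>u v. g i x (J i x u) (J i x v) = g i x u v) \<and>
     (\<forall>i X Y. smooth_on X (chart_im A i) \<longrightarrow> smooth_on Y (chart_im A i) \<longrightarrow>
        (\<forall>x\<in>chart_im A i. nabla (g i) X (\<lambda>y. J i y (Y y)) x = J i x (nabla (g i) X Y x)))"

section \<open>The cotangent bundle and the Berger-type deformed Sasaki metric\<close>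

text \<open>
  The charts of the cotangent bundle are those induced by the charts of the base, with the same
  index type; the coordinates of \<open>(x, \<omega>)\<close> are \<open>(x\<^sup>i, p\<^sub>i)\<close> in \<open>'e \<times> 'e\<close>.
\<close>

definition cotangent ::
  "('i, 'a, 'e::euclidean_space) atlas \<Rightarrow> ('i, 'a \<times> ('i \<Rightarrow> 'e), 'e \<times> 'e) atlas" where
  "cotangent A i = ({(x, \<omega>). x \<in> chart_dom A i \<and> covector_at A x \<omega>},
                    \<lambda>(x, \<omega>). (chart_map A i x, \<omega> i))"

definition covec_J :: "('e \<Rightarrow> 'e) \<Rightarrow> 'e::euclidean_space \<Rightarrow> 'e" where
  "covec_J J \<omega> = covec (\<lambda>v. \<omega> \<bullet> J v)"

definition hlift ::
  "('e \<Rightarrow> 'e \<Rightarrow> 'e \<Rightarrow> real) \<Rightarrow> 'e \<times> 'e \<Rightarrow> 'e \<Rightarrow> 'e::euclidean_space \<times> 'e" where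
  "hlift g = (\<lambda>(x, p) X. (X, covec (\<lambda>v. p \<bullet> christoffel g x v X)))"

definition vlift :: "'e \<Rightarrow> 'e::euclidean_space \<times> 'e" where
  "vlift \<omega> = (0, \<omega>)"

text \<open>
  A tangent vector \<open>\<xi>\<close> of the cotangent bundle at \<open>(x, p)\<close> is uniquely \<open>\<^sup>HX + \<^sup>V\<omega>\<close> with
  \<open>X = fst \<xi>\<close> and \<open>\<omega> = vpart g (x, p) \<xi>\<close>.
\<close>

definition vpart ::
  "('e \<Rightarrow> 'e \<Rightarrow> 'e \<Rightarrow> real) \<Rightarrow> 'e \<times> 'e \<Rightarrow> 'e \<times> 'e \<Rightarrow> 'e::euclidean_space" where
  "vpart g z \<xi> = snd \<xi> - snd (hlift g z (fst \<xi>))"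

definition berger_sasaki ::
  "real \<Rightarrow> ('i \<Rightarrow> 'e \<Rightarrow> 'e \<Rightarrow> 'e) \<Rightarrow> ('i, 'e) metric \<Rightarrow> ('i, 'e::euclidean_space \<times> 'e) metric" where
  "berger_sasaki \<delta> J g i = (\<lambda>(x, p) \<xi> \<eta>.
     let G = g i x; pJ = covec_J (J i x) p;
         \<omega> = vpart (g i) (x, p) \<xi>; \<theta> = vpart (g i) (x, p) \<eta>
     in G (fst \<xi>) (fst \<eta>) + (cometric G \<omega> \<theta> + \<delta>\<^sup>2 * cometric G \<omega> pJ * cometric G \<theta> pJ))"

lemma hlift_vlift_decomp: "\<xi> = hlift g z (fst \<xi>) + vlift (vpart g z \<xi>)"
  by (cases \<xi>) (auto simp: hlift_def vlift_def vpart_def split: prod.split)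

lemma vpart_hlift [simp]: "vpart g z (hlift g z X) = 0"
  by (auto simp: hlift_def vpart_def split: prod.split)

lemma vpart_vlift:
  assumes "\<And>v. christoffel g (fst z) v 0 = 0"
  shows "vpart g z (vlift \<omega>) = \<omega>"
  using assms by (auto simp: hlift_def vlift_def vpart_def covec_def split: prod.split)

text \<open>The defining equations of the metric, for all lifts.\<close>

lemma
  fixes A :: "('i, 'a, 'c::euclidean_space) atlas"
  assumes g: "riemannian_metric A g" and x: "x \<in> chart_im A i" and op: "open (chart_im A i)"
  shows berger_sasaki_HH:
      "berger_sasaki \<delta> J g i (x, p) (hlift (g i) (x, p) X) (hlift (g i) (x, p) Y) = g i x X Y"
    and berger_sasaki_HV:
      "berger_sasaki \<delta> J g i (x, p) (hlift (g i) (x, p) X) (vlift \<theta>) = 0"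
    and berger_sasaki_VV:
      "berger_sasaki \<delta> J g i (x, p) (vlift \<omega>) (vlift \<theta>) =
         cometric (g i x) \<omega> \<theta>
         + \<delta>\<^sup>2 * cometric (g i x) \<omega> (covec_J (J i x) p) * cometric (g i x) \<theta> (covec_J (J i x) p)"
proof -
  have bil: "bilinear (g i y)" and pos: "\<And>u. u \<noteq> 0 \<Longrightarrow> g i y u u > 0" if "y \<in> chart_im A i" for y
    using g that by (auto simp: riemannian_metric_def)
  have sharp0: "sharp (g i x) 0 = 0"
    using bil pos x by (intro sharp_eqI) (auto simp: bilinear_lzero)
  have zero: "frechet_derivative (\<lambda>y. g i y a b) (at x) = (\<lambda>_. 0)" if "a = 0 \<or> b = 0" for a b
  proof -
    have "((\<lambda>y. g i y a b) has_derivative (\<lambda>_. 0)) (at x)"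
      by (rule has_derivative_transform_within_open[OF has_derivative_const op x])
        (use that bil in \<open>auto simp: bilinear_lzero bilinear_rzero\<close>)
    then show ?thesis by (simp add: frechet_derivative_at[symmetric])
  qed
  have lin: "frechet_derivative (\<lambda>y. g i y a b) (at x) 0 = 0" for a b
  proof -
    have "ck_on (Suc 0) (\<lambda>x. g i x a b) (chart_im A i)"
      using g by (auto simp: riemannian_metric_def smooth_on_def)
    then have "(\<lambda>y. g i y a b) differentiable (at x)" using x by simp
    then show ?thesis by (simp add: linear_0 linear_frechet_derivative)
  qed
  have chr: "christoffel (g i) x v 0 = 0" for v
    by (simp add: christoffel_def zero lin covec_def sharp0)
  have vv: "vpart (g i) (x, p) (vlift \<theta>) = \<theta>" for \<theta>
    by (rule vpart_vlift) (simp add: chr)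
  have fst [simp]: "fst (hlift (g i) (x, p) X) = X" "fst (vlift \<theta>) = 0"
    for X \<theta> :: 'c by (auto simp: hlift_def vlift_def)
  have com0 [simp]: "cometric (g i x) 0 \<theta> = 0" "cometric (g i x) \<theta> 0 = 0" for \<theta>
    using bil[OF x] by (auto simp: cometric_def sharp0 bilinear_lzero bilinear_rzero)
  show "berger_sasaki \<delta> J g i (x, p) (hlift (g i) (x, p) X) (hlift (g i) (x, p) Y) = g i x X Y"
    "berger_sasaki \<delta> J g i (x, p) (hlift (g i) (x, p) X) (vlift \<theta>) = 0"
    "berger_sasaki \<delta> J g i (x, p) (vlift \<omega>) (vlift \<theta>) =
         cometric (g i x) \<omega> \<theta>
         + \<delta>\<^sup>2 * cometric (g i x) \<omega> (covec_J (J i x) p) * cometric (g i x) \<theta> (covec_J (J i x) p)"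
    using bil[OF x] by (auto simp: berger_sasaki_def Let_def vv bilinear_lzero bilinear_rzero)
qed

end

theory Submission
  imports Defs
begin

text \<open>
  In a chart, the geodesic equation tested against a tangent vector \<open>\<eta>\<close> is the Euler--Lagrange
  equation of the energy
  \<open>\<onehalf> (g(\<gamma>', \<gamma>') + g\<^sup>-\<^sup>1(\<vartheta>', \<vartheta>') + \<delta>\<^sup>2 g\<^sup>-\<^sup>1(\<vartheta>', \<vartheta>J)\<^sup>2)\<close>.
  Since \<open>g\<close> and \<open>J\<close> are parallel, all derivatives can be replaced by covariant ones, and the two orders
  of differentiating \<open>\<vartheta>'\<close> differ by \<open>\<vartheta> \<circ> R\<close>. For \<open>\<alpha> = \<vartheta>'\<close> and \<open>k = \<delta>\<^sup>2 g\<^sup>-\<^sup>1(\<alpha>, \<vartheta>J)\<close>, horizontal \<open>\<eta>\<close> give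
  \<open>\<gamma>'' = R(\<alpha> + k \<vartheta>J, \<vartheta>)\<gamma>'\<close> (with indices raised) by the pair symmetry of \<open>R\<close>, and vertical \<open>\<eta>\<close>
  give \<open>\<vartheta>'' + \<delta>\<^sup>2 g\<^sup>-\<^sup>1(\<vartheta>'', \<vartheta>J) \<vartheta>J + 2k \<alpha>J = 0\<close>. Pairing the latter with \<open>\<vartheta>J\<close> determines
  \<open>g\<^sup>-\<^sup>1(\<vartheta>'', \<vartheta>J)\<close>, which introduces the denominator \<open>\<lambda>\<close>.
\<close>

section \<open>Derivatives of families of linear and bilinear maps\<close>

text \<open>Near a zero of \<open>f\<close>, \<open>f y\<close> is O(norm (y - x)) while
  \<open>h y - h x\<close> tends to 0, so their product is negligible to first order. This serves
  \<open>sharp_differentiable\<close>, where the scalar factor is at first known only to be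
  continuous.\<close>

lemma has_derivative_scaleR_vanishing:
  fixes f :: "'a::real_normed_vector \<Rightarrow> 'b::real_normed_vector" and h :: "'a \<Rightarrow> real"
  assumes f: "(f has_derivative f') (at x)" and f0: "f x = 0" and h: "isCont h x"
  shows "((\<lambda>y. h y *\<^sub>R f y) has_derivative (\<lambda>v. h x *\<^sub>R f' v)) (at x)"
proof -
  interpret f': bounded_linear f'
    using f by (rule has_derivative_bounded_linear)
  obtain K where K: "K > 0" "\<And>v. norm (f' v) \<le> norm v * K"
    using f'.pos_bounded by blast
  obtain d1 where d1: "d1 > 0" "\<And>y. norm (y - x) < d1 \<Longrightarrow> norm (f y - f' (y - x)) \<le> norm (y - x)"
    using f f0 unfolding has_derivative_at_alt by (metis diff_zero mult_1 zero_less_one)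
  have f_le: "norm (f y) \<le> (K + 1) * norm (y - x)" if "norm (y - x) < d1" for y
    using d1(2)[OF that] K(2)[of "y - x"] norm_triangle_ineq[of "f y - f' (y - x)" "f' (y - x)"]
    by (simp add: algebra_simps)
  have "((\<lambda>y. (h y - h x) *\<^sub>R f y) has_derivative (\<lambda>v. 0)) (at x)"
    unfolding has_derivative_at_alt
  proof (intro conjI allI impI)
    fix e :: real assume "e > 0"
    then have "e / (K + 1) > 0" using K(1) by simp
    then obtain d2 where d2: "d2 > 0" "\<And>y. dist y x < d2 \<Longrightarrow> dist (h y) (h x) < e / (K + 1)"
      using h unfolding continuous_at_eps_delta by blast
    show "\<exists>d>0. \<forall>y. norm (y - x) < d \<longrightarrow>
        norm ((h y - h x) *\<^sub>R f y - (h x - h x) *\<^sub>R f x - 0) \<le> e * norm (y - x)"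
    proof (intro exI[of _ "min d1 d2"] conjI allI impI)
      fix y assume y: "norm (y - x) < min d1 d2"
      have "\<bar>h y - h x\<bar> * norm (f y) \<le> e / (K + 1) * ((K + 1) * norm (y - x))"
        using y d2(2)[of y] f_le[of y] \<open>e / (K + 1) > 0\<close>
        by (intro mult_mono) (auto simp: dist_norm)
      then show "norm ((h y - h x) *\<^sub>R f y - (h x - h x) *\<^sub>R f x - 0) \<le> e * norm (y - x)"
        using K(1) by simp
    qed (use d1 d2 in auto)
  qed simp
  from has_derivative_add[OF this has_derivative_scaleR_right[OF f, of "h x"]]
  show ?thesis by (simp add: algebra_simps)
qed

section \<open>Symmetry of second derivatives\<close>

text \<open>The mean value theorem along \<open>u\<close> turns the second difference into a
  difference of \<open>u\<close>-derivatives, and their linear approximation at \<open>x\<close>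
  gives the limit.\<close>

lemma second_difference_tendsto:
  fixes f :: "'a::real_normed_vector \<Rightarrow> real"
  assumes S: "open S" "x \<in> S" and f: "\<And>y. y \<in> S \<Longrightarrow> f differentiable (at y)"
    and D: "((\<lambda>y. frechet_derivative f (at y) u) has_derivative D) (at x)"
  shows "((\<lambda>t. (f (x + t *\<^sub>R u + t *\<^sub>R v) - f (x + t *\<^sub>R u) - f (x + t *\<^sub>R v) + f x) / t\<^sup>2) \<longlongrightarrow> D v)
    (at_right 0)"
proof (rule tendstoI)
  interpret D: bounded_linear D
    using D by (rule has_derivative_bounded_linear)
  \<comment> \<open>\<open>2 * norm u + norm v\<close> collects the lengths in the two first-order
    errors \<open>b1\<close> and \<open>b2\<close>; the summand 1 keeps \<open>K\<close> positive
    and the final estimate strict.\<close>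
  define K where "K = 2 * norm u + norm v + 1"
  have K: "K > 0" by (simp add: K_def add_nonneg_pos)
  let ?h = "\<lambda>y. frechet_derivative f (at y) u"
  fix e :: real assume "e > 0"
  then have "e / (2 * K) > 0" using K by simp
  then obtain d1 where d1: "d1 > 0"
    "\<And>y. norm (y - x) < d1 \<Longrightarrow> norm (?h y - ?h x - D (y - x)) \<le> e / (2 * K) * norm (y - x)"
    using D unfolding has_derivative_at_alt by blast
  obtain d2 where d2: "d2 > 0" "ball x d2 \<subseteq> S"
    using S open_contains_ball by blast
  have near: "norm (s *\<^sub>R u + r *\<^sub>R v) \<le> t * K \<and> norm (s *\<^sub>R u + r *\<^sub>R v) \<le> \<bar>s\<bar> * norm u + \<bar>r\<bar> * norm v"
    if "0 \<le> s" "s \<le> t" "0 \<le> r" "r \<le> t" for s r t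
  proof -
    have "norm (s *\<^sub>R u + r *\<^sub>R v) \<le> \<bar>s\<bar> * norm u + \<bar>r\<bar> * norm v"
      by (metis norm_scaleR norm_triangle_ineq)
    moreover have "\<bar>s\<bar> * norm u \<le> t * norm u" "\<bar>r\<bar> * norm v \<le> t * norm v"
      using that by (auto intro!: mult_right_mono)
    moreover have "t * norm u + t * norm v \<le> t * K"
      using that unfolding K_def distrib_left[symmetric] by (intro mult_left_mono) auto
    ultimately show ?thesis by linarith
  qed
  define d where "d = min d1 d2 / K"
  have "d > 0" using d1 d2 K by (simp add: d_def)
  moreover have "dist ((f (x + t *\<^sub>R u + t *\<^sub>R v) - f (x + t *\<^sub>R u) - f (x + t *\<^sub>R v) + f x) / t\<^sup>2) (D v) < e"
    if t: "0 < t" "t < d" for t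
  proof -
    have tK: "t * K < d1" "t * K < d2"
      using t K by (auto simp: d_def pos_less_divide_eq)
    have inS: "x + s *\<^sub>R u + r *\<^sub>R v \<in> S" "norm (s *\<^sub>R u + r *\<^sub>R v) < d1"
      if "0 \<le> s" "s \<le> t" "0 \<le> r" "r \<le> t" for s r
      using near[OF that] tK d2(2) by (auto simp: dist_norm subset_iff algebra_simps norm_minus_commute)
    \<comment> \<open>The second difference is the increment \<open>\<phi> t - \<phi> 0\<close> of a
      function of one variable.\<close>
    define \<phi> where "\<phi> s = f (x + s *\<^sub>R u + t *\<^sub>R v) - f (x + s *\<^sub>R u)" for s
    define \<phi>' where "\<phi>' s = ?h (x + s *\<^sub>R u + t *\<^sub>R v) - ?h (x + s *\<^sub>R u)" for s
    have \<phi>: "(\<phi> has_real_derivative \<phi>' s) (at s)" if "0 \<le> s" "s \<le> t" for s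
    proof -
      have "((\<lambda>s. f (x + s *\<^sub>R u + r *\<^sub>R v)) has_derivative
          (\<lambda>k. k * ?h (x + s *\<^sub>R u + r *\<^sub>R v))) (at s)" if "r = 0 \<or> r = t" for r
      proof -
        have *: "(f has_derivative frechet_derivative f (at (x + s *\<^sub>R u + r *\<^sub>R v)))
            (at (x + s *\<^sub>R u + r *\<^sub>R v))"
          using f inS(1)[of s r] that \<open>0 \<le> s\<close> \<open>s \<le> t\<close> t frechet_derivative_works by fastforce
        have "((\<lambda>s. x + s *\<^sub>R u + r *\<^sub>R v) has_derivative (\<lambda>k. k *\<^sub>R u)) (at s)"
          by (auto intro!: derivative_eq_intros)
        from has_derivative_compose[OF this *] show ?thesis
          by (simp add: linear_scale[OF has_derivative_linear[OF *]])
      qed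
      from has_derivative_diff[OF this[of t] this[of 0]] show ?thesis
        unfolding has_field_derivative_def \<phi>_def \<phi>'_def
        by (auto elim!: has_derivative_eq_rhs simp: algebra_simps)
    qed
    obtain s where s: "0 < s" "s < t" "\<phi> t - \<phi> 0 = (t - 0) * \<phi>' s"
      using MVT2[of 0 t \<phi> \<phi>'] \<phi> t by blast
    have b1: "\<bar>?h (x + s *\<^sub>R u + t *\<^sub>R v) - ?h x - D (s *\<^sub>R u + t *\<^sub>R v)\<bar>
        \<le> e / (2 * K) * (s * norm u + t * norm v)"
    proof -
      have "\<bar>?h (x + s *\<^sub>R u + t *\<^sub>R v) - ?h x - D (s *\<^sub>R u + t *\<^sub>R v)\<bar>
          \<le> e / (2 * K) * norm (s *\<^sub>R u + t *\<^sub>R v)"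
        using d1(2)[of "x + s *\<^sub>R u + t *\<^sub>R v"] inS(2)[of s t] s t by (simp add: add.assoc)
      also have "\<dots> \<le> e / (2 * K) * (s * norm u + t * norm v)"
        using near[of s t t] s t \<open>e / (2 * K) > 0\<close> by (intro mult_left_mono) auto
      finally show ?thesis .
    qed
    have b2: "\<bar>?h (x + s *\<^sub>R u) - ?h x - D (s *\<^sub>R u)\<bar> \<le> e / (2 * K) * (s * norm u)"
      using d1(2)[of "x + s *\<^sub>R u"] inS(2)[of s 0] s t by (simp add: abs_of_pos)
    have "\<bar>\<phi>' s - t * D v\<bar> \<le> e / (2 * K) * (s * norm u + t * norm v) + e / (2 * K) * (s * norm u)"
      using b1 b2 unfolding \<phi>'_def by (simp add: D.add D.scaleR abs_le_iff)
    also have "\<dots> = e / (2 * K) * (2 * s * norm u + t * norm v)"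
      by (simp add: algebra_simps)
    also have "\<dots> < e / (2 * K) * (2 * (t * K))"
    proof (rule mult_strict_left_mono[OF _ \<open>e / (2 * K) > 0\<close>])
      have "s * norm u \<le> t * norm u" using s by (intro mult_right_mono) auto
      moreover have "t * norm v \<ge> 0" "t * norm u \<ge> 0" using t by auto
      moreover have **: "2 * (t * K) = 4 * (t * norm u) + 2 * (t * norm v) + 2 * t"
        by (simp add: K_def algebra_simps)
      ultimately show "2 * s * norm u + t * norm v < 2 * (t * K)"
        using t mult.assoc[of 2 s "norm u"] ** by linarith
    qed
    also have "\<dots> = e * t" using K by simp
    finally have le: "\<bar>\<phi>' s - t * D v\<bar> < e * t" .
    have "(f (x + t *\<^sub>R u + t *\<^sub>R v) - f (x + t *\<^sub>R u) - f (x + t *\<^sub>R v) + f x) = t * \<phi>' s"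
      using s(3) by (simp add: \<phi>_def)
    then have "dist ((f (x + t *\<^sub>R u + t *\<^sub>R v) - f (x + t *\<^sub>R u) - f (x + t *\<^sub>R v) + f x) / t\<^sup>2) (D v)
        = \<bar>(\<phi>' s - t * D v) / t\<bar>"
      using t by (simp add: dist_real_def power2_eq_square diff_divide_distrib)
    also have "\<dots> < e" using le t by (simp add: pos_divide_less_eq)
    finally show ?thesis .
  qed
  ultimately show "\<forall>\<^sub>F t in at_right 0. dist ((f (x + t *\<^sub>R u + t *\<^sub>R v) - f (x + t *\<^sub>R u)
      - f (x + t *\<^sub>R v) + f x) / t\<^sup>2) (D v) < e"
    unfolding eventually_at_right_field by blast
qed

text \<open>The second difference quotient does not distinguish \<open>u\<close> from
  \<open>v\<close>, so both mixed derivatives are its limit.\<close>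

lemma second_derivative_symmetric:
  fixes f :: "'a::real_normed_vector \<Rightarrow> real"
  assumes "open S" "x \<in> S" "\<And>y. y \<in> S \<Longrightarrow> f differentiable (at y)"
    and "\<And>w. (\<lambda>y. frechet_derivative f (at y) w) differentiable (at x)"
  shows "frechet_derivative (\<lambda>y. frechet_derivative f (at y) u) (at x) v =
    frechet_derivative (\<lambda>y. frechet_derivative f (at y) v) (at x) u"
proof -
  note T = second_difference_tendsto[OF assms(1-3) assms(4)[unfolded frechet_derivative_works]]
  show ?thesis
    by (rule tendsto_unique[OF _ T[of u v]]) (use T[of v u] in \<open>simp_all add: algebra_simps\<close>)
qed

section \<open>Product rules for families of maps\<close>

text \<open>Expanding in the basis makes the family a finite sum of products with coefficients
  \<open>F y i j\<close>, so differentiability on fixed vectors yields the rule for moving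
  ones.\<close>

lemma has_derivative_bilinear_family:
  fixes F :: "'e::euclidean_space \<Rightarrow> 'e \<Rightarrow> 'e \<Rightarrow> 'b::real_normed_vector"
    and X a b :: "'z::real_normed_vector \<Rightarrow> 'e"
  assumes U: "open U" "X z \<in> U" and bil: "\<And>y. y \<in> U \<Longrightarrow> bilinear (F y)"
    and diff: "\<And>u v. (\<lambda>y. F y u v) differentiable (at (X z))"
    and X: "(X has_derivative X') (at z)" and a: "(a has_derivative a') (at z)"
    and b: "(b has_derivative b') (at z)"
  shows "((\<lambda>z. F (X z) (a z) (b z)) has_derivative
    (\<lambda>h. frechet_derivative (\<lambda>y. F y (a z) (b z)) (at (X z)) (X' h)
       + F (X z) (a' h) (b z) + F (X z) (a z) (b' h))) (at z)"
proof -
  have expand: "F y u v = (\<Sum>i\<in>Basis. \<Sum>j\<in>Basis. ((u \<bullet> i) * (v \<bullet> j)) *\<^sub>R F y i j)" if "y \<in> U" for y u v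
  proof -
    interpret bounded_bilinear "F y"
      using bil[OF that] by (simp add: bilinear_conv_bounded_bilinear)
    have "F y u v = F y (\<Sum>i\<in>Basis. (u \<bullet> i) *\<^sub>R i) (\<Sum>j\<in>Basis. (v \<bullet> j) *\<^sub>R j)"
      by (simp add: euclidean_representation)
    also have "\<dots> = (\<Sum>i\<in>Basis. \<Sum>j\<in>Basis. ((u \<bullet> i) * (v \<bullet> j)) *\<^sub>R F y i j)"
      unfolding sum_left by (simp add: sum_right scaleR_left scaleR_right mult.commute)
    finally show ?thesis .
  qed
  define D where "D u v = frechet_derivative (\<lambda>y. F y u v) (at (X z))" for u v
  have D: "((\<lambda>y. F y u v) has_derivative D u v) (at (X z))" for u v
    using diff unfolding D_def frechet_derivative_works .
  \<comment> \<open>The domain type is arbitrary: this is applied to the given \<open>X\<close>,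
    \<open>a\<close>, \<open>b\<close>, and in \<open>Dexp\<close> to the identity and constants on
    the model space. The latter use shows that the derivative of \<open>F\<close> is bilinear in the
    fixed vectors, so the sums can be folded up again.\<close>
  have main: "((\<lambda>z. F (X z) (a z) (b z)) has_derivative (\<lambda>h. \<Sum>i\<in>Basis. \<Sum>j\<in>Basis.
       ((a z \<bullet> i) * (b z \<bullet> j)) *\<^sub>R D i j (X' h)
     + ((a z \<bullet> i) * (b' h \<bullet> j) + (a' h \<bullet> i) * (b z \<bullet> j)) *\<^sub>R F (X z) i j)) (at z)"
    if U: "X z \<in> U" and X: "(X has_derivative X') (at z)"
      and a: "(a has_derivative a') (at z)" and b: "(b has_derivative b') (at z)"
      and D: "\<And>u v. ((\<lambda>y. F y u v) has_derivative D u v) (at (X z))"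
    for X a b :: "'w::real_normed_vector \<Rightarrow> 'e" and z X' a' b'
  proof (rule has_derivative_transform_eventually)
    show "((\<lambda>z. \<Sum>i\<in>Basis. \<Sum>j\<in>Basis. ((a z \<bullet> i) * (b z \<bullet> j)) *\<^sub>R F (X z) i j) has_derivative
      (\<lambda>h. \<Sum>i\<in>Basis. \<Sum>j\<in>Basis. ((a z \<bullet> i) * (b z \<bullet> j)) *\<^sub>R D i j (X' h)
       + ((a z \<bullet> i) * (b' h \<bullet> j) + (a' h \<bullet> i) * (b z \<bullet> j)) *\<^sub>R F (X z) i j)) (at z)"
      by (intro has_derivative_sum has_derivative_scaleR has_derivative_mult
          has_derivative_inner_left a b has_derivative_compose[OF X D])
    have "\<forall>\<^sub>F w in at z. X w \<in> U"
      using has_derivative_continuous[OF X] topological_tendstoD[OF _ \<open>open U\<close> U]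
      by (simp add: continuous_at)
    then show "\<forall>\<^sub>F w in at z. (\<Sum>i\<in>Basis. \<Sum>j\<in>Basis. ((a w \<bullet> i) * (b w \<bullet> j)) *\<^sub>R F (X w) i j)
        = F (X w) (a w) (b w)"
      by eventually_elim (simp add: expand)
  qed (use U in \<open>simp_all add: expand\<close>)
  have Dexp: "D u v w = (\<Sum>i\<in>Basis. \<Sum>j\<in>Basis. ((u \<bullet> i) * (v \<bullet> j)) *\<^sub>R D i j w)" for u v w
  proof -
    have "((\<lambda>y. F y u v) has_derivative (\<lambda>h. \<Sum>i\<in>Basis. \<Sum>j\<in>Basis. ((u \<bullet> i) * (v \<bullet> j)) *\<^sub>R D i j h
        + ((u \<bullet> i) * (0 \<bullet> j) + (0 \<bullet> i) * (v \<bullet> j)) *\<^sub>R F (X z) i j)) (at (X z))"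
      by (rule main) (use U D in \<open>auto intro: derivative_eq_intros\<close>)
    from has_derivative_unique[OF this D] show ?thesis by (simp add: fun_eq_iff)
  qed
  from main[OF U(2) X a b D] show ?thesis
    unfolding D_def[symmetric]
    by (rule has_derivative_eq_rhs)
      (simp add: Dexp[of "a z" "b z"] expand[OF U(2), of "a' _" "b z"] expand[OF U(2), of "a z" "b' _"]
        sum.distrib scaleR_add_left add.assoc fun_eq_iff add.commute add.left_commute)
qed

lemma bilinear_frechet_derivative_family:
  fixes F :: "'e::euclidean_space \<Rightarrow> 'e \<Rightarrow> 'e \<Rightarrow> 'b::real_normed_vector"
  assumes U: "open U" "x \<in> U" and bil: "\<And>y. y \<in> U \<Longrightarrow> bilinear (F y)"
    and diff: "\<And>u v. (\<lambda>y. F y u v) differentiable (at x)"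
  shows "bilinear (\<lambda>u v. frechet_derivative (\<lambda>y. F y u v) (at x) w)"
proof -
  have D: "((\<lambda>y. F y u v) has_derivative frechet_derivative (\<lambda>y. F y u v) (at x)) (at x)" for u v
    using diff unfolding frechet_derivative_works .
  have eq: "frechet_derivative (\<lambda>y. F y u v) (at x) = f'"
    if "(f has_derivative f') (at x)" "\<And>y. y \<in> U \<Longrightarrow> f y = F y u v" for u v f f'
    using has_derivative_transform_within_open[OF that(1) U that(2)] D has_derivative_unique by blast
  note b = bilinear_ladd[OF bil] bilinear_radd[OF bil] bilinear_lmul[OF bil] bilinear_rmul[OF bil]
  show ?thesis
    unfolding bilinear_def
    by (intro conjI allI linearI; subst eq[OF has_derivative_add[OF D D]] eq[OF has_derivative_scaleR_right[OF D]])
      (simp_all add: b)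
qed

text \<open>A dummy factor \<open>v \<bullet> k\<close>, kept at \<open>v = k\<close> for a basis
  vector \<open>k\<close>, makes the family bilinear.\<close>

lemma has_derivative_linear_family:
  fixes F :: "'e::euclidean_space \<Rightarrow> 'e \<Rightarrow> 'b::real_normed_vector"
    and X a :: "'z::real_normed_vector \<Rightarrow> 'e"
  assumes U: "open U" "X z \<in> U" and lin: "\<And>y. y \<in> U \<Longrightarrow> linear (F y)"
    and diff: "\<And>u. (\<lambda>y. F y u) differentiable (at (X z))"
    and X: "(X has_derivative X') (at z)" and a: "(a has_derivative a') (at z)"
  shows "((\<lambda>z. F (X z) (a z)) has_derivative
    (\<lambda>h. frechet_derivative (\<lambda>y. F y (a z)) (at (X z)) (X' h) + F (X z) (a' h))) (at z)"
proof -
  obtain k :: 'e where k: "k \<in> Basis" using nonempty_Basis by blast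
  have "bilinear (\<lambda>u v. (v \<bullet> k) *\<^sub>R F y u)" if "y \<in> U" for y
    using lin[OF that] unfolding bilinear_def
    by (auto intro!: linearI simp: linear_add linear_scale algebra_simps inner_add_left)
  from has_derivative_bilinear_family[where X = X and z = z and F = "\<lambda>y u v. (v \<bullet> k) *\<^sub>R F y u",
      OF U this _ X a has_derivative_const[of k]]
  show ?thesis using k diff by (simp add: inner_same_Basis)
qed

section \<open>Riemannian metrics in a chart\<close>

lemma inner_eqI: "(\<And>w. u \<bullet> w = v \<bullet> w) \<Longrightarrow> u = v"
  by (metis vector_eq_ldot inner_commute)

lemma smooth_on_differentiable:
  "smooth_on f S \<Longrightarrow> x \<in> S \<Longrightarrow> f differentiable (at x)"
  unfolding smooth_on_def by (metis ck_on.simps(2))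

lemma smooth_on_frechet_derivative:
  "smooth_on f S \<Longrightarrow> smooth_on (\<lambda>x. frechet_derivative f (at x) v) S"
  unfolding smooth_on_def by (metis ck_on.simps(2))

lemma linear_covec:
  assumes "\<And>v. linear (\<lambda>\<omega>. f \<omega> v)"
  shows "linear (\<lambda>\<omega>. covec (f \<omega>))"
  by (rule linearI) (simp_all add: covec_def linear_add[OF assms] linear_scale[OF assms]
      scaleR_add_left sum.distrib scaleR_sum_right)

lemma frechet_derivative_eqI: "(f has_derivative f') (at x) \<Longrightarrow> frechet_derivative f (at x) = f'"
  using frechet_derivative_at by metis

text \<open>The definite description in \<open>sharp\<close> has a value: by positivity the map from
  \<open>w\<close> to the covector of \<open>G w\<close> is injective, hence surjective in finite
  dimension.\<close>

lemma inner_product_sharp: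
  fixes G :: "'e::euclidean_space \<Rightarrow> 'e \<Rightarrow> real"
  assumes G: "bilinear G" and pos: "\<And>u. u \<noteq> 0 \<Longrightarrow> G u u > 0"
  shows "G (sharp G \<omega>) v = \<omega> \<bullet> v"
proof -
  let ?f = "\<lambda>w. covec (G w)"
  have f: "?f w \<bullet> v = G w v" for w v
    using G by (intro covec_inner) (simp add: bilinear_def)
  have "linear ?f"
    using G by (intro linear_covec) (simp add: bilinear_def)
  moreover have "inj ?f"
  proof (rule injI)
    fix u v assume "?f u = ?f v"
    then have "G (u - v) (u - v) = 0"
      using f by (metis bilinear_lsub[OF G] diff_self)
    then show "u = v" using pos[of "u - v"] by force
  qed
  ultimately have "surj ?f" by (rule linear_inj_imp_surj)
  then obtain w where w: "?f w = \<omega>" by (metis surjD)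
  have "sharp G \<omega> = w"
    using G pos by (rule sharp_eqI) (use f w in metis)+
  with w f show ?thesis by metis
qed

text \<open>One derivative of the coefficients suffices for Christoffel symbols. The base metric and
  the bundle metric are both treated as instances.\<close>

locale metric_chart =
  fixes U :: "'e::euclidean_space set" and g :: "'e \<Rightarrow> 'e \<Rightarrow> 'e \<Rightarrow> real"
  assumes open_U: "open U"
    and bilinear_g: "x \<in> U \<Longrightarrow> bilinear (g x)"
    and g_sym: "x \<in> U \<Longrightarrow> g x u v = g x v u"
    and g_pos: "x \<in> U \<Longrightarrow> u \<noteq> 0 \<Longrightarrow> g x u u > 0"
    and g_differentiable: "x \<in> U \<Longrightarrow> (\<lambda>y. g y u v) differentiable (at x)"
begin

lemma bounded_bilinear_g: "x \<in> U \<Longrightarrow> bounded_bilinear (g x)"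
  using bilinear_g by (simp add: bilinear_conv_bounded_bilinear)

lemmas g_add_left = bilinear_ladd[OF bilinear_g]
  and g_add_right = bilinear_radd[OF bilinear_g]
  and g_diff_left = bilinear_lsub[OF bilinear_g]
  and g_diff_right = bilinear_rsub[OF bilinear_g]
  and g_neg_left = bilinear_lneg[OF bilinear_g]
  and g_neg_right = bilinear_rneg[OF bilinear_g]
  and g_scale_left = bilinear_lmul[OF bilinear_g, unfolded real_scaleR_def]
  and g_scale_right = bilinear_rmul[OF bilinear_g, unfolded real_scaleR_def]

lemma linear_g_left: "x \<in> U \<Longrightarrow> linear (\<lambda>u. g x u v)"
  and linear_g_right: "x \<in> U \<Longrightarrow> linear (g x u)"
  using bilinear_g by (auto simp: bilinear_def)

lemma g_eqI:
  assumes "x \<in> U" "\<And>w. g x u w = g x v w"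
  shows "u = v"
proof -
  have "g x (u - v) (u - v) = 0"
    using assms by (simp add: g_diff_left)
  then show ?thesis
    using g_pos[OF assms(1), of "u - v"] by force
qed

lemma g_sharp: "x \<in> U \<Longrightarrow> g x (sharp (g x) \<omega>) v = \<omega> \<bullet> v"
  using bilinear_g g_pos by (rule inner_product_sharp)

lemma g_sharp': "x \<in> U \<Longrightarrow> g x v (sharp (g x) \<omega>) = \<omega> \<bullet> v"
  using g_sharp g_sym by metis

lemma sharp_unique: "x \<in> U \<Longrightarrow> (\<And>v. g x w v = \<omega> \<bullet> v) \<Longrightarrow> sharp (g x) \<omega> = w"
  by (rule g_eqI[of x]) (simp_all add: g_sharp)

lemma linear_sharp:
  assumes "x \<in> U"
  shows "linear (sharp (g x))"
  by (intro linearI sharp_unique assms)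
    (simp_all add: assms g_add_left g_scale_left g_sharp inner_add_left)

lemma inner_sharp: "x \<in> U \<Longrightarrow> \<alpha> \<bullet> sharp (g x) \<beta> = cometric (g x) \<alpha> \<beta>"
  by (simp add: cometric_def g_sharp)

lemma cometric_sym: "x \<in> U \<Longrightarrow> cometric (g x) \<alpha> \<beta> = cometric (g x) \<beta> \<alpha>"
  by (simp add: cometric_def g_sym)

lemma bilinear_cometric: "x \<in> U \<Longrightarrow> bilinear (cometric (g x))"
  unfolding bilinear_def cometric_def
  by (intro conjI allI)
    (auto intro: linear_compose[OF linear_sharp linear_g_left, unfolded o_def]
       linear_compose[OF linear_sharp linear_g_right, unfolded o_def])

lemma cometric_pos:
  assumes x: "x \<in> U" and "\<omega> \<noteq> 0"
  shows "cometric (g x) \<omega> \<omega> > 0"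
proof -
  have "sharp (g x) \<omega> \<noteq> 0"
    using g_sharp[OF x, of \<omega> \<omega>] assms bilinear_lzero[OF bilinear_g[OF x]] by fastforce
  then show ?thesis unfolding cometric_def by (rule g_pos[OF x])
qed

section \<open>Christoffel symbols and metric compatibility\<close>

definition dg :: "'e \<Rightarrow> 'e \<Rightarrow> 'e \<Rightarrow> 'e \<Rightarrow> real" where
  "dg x w u v = frechet_derivative (\<lambda>y. g y u v) (at x) w"

lemma bilinear_dg: "x \<in> U \<Longrightarrow> bilinear (dg x w)"
  unfolding dg_def[abs_def] using open_U bilinear_g g_differentiable
  by (intro bilinear_frechet_derivative_family)

lemma linear_dg: "x \<in> U \<Longrightarrow> linear (\<lambda>w. dg x w u v)"
  unfolding dg_def using linear_frechet_derivative[OF g_differentiable] .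

lemma dg_sym: "x \<in> U \<Longrightarrow> dg x w u v = dg x w v u"
  unfolding dg_def
  by (rule fun_cong[OF frechet_derivative_eqI])
    (rule has_derivative_transform_within_open[OF
        g_differentiable[unfolded frechet_derivative_works] open_U], auto simp: g_sym)

text \<open>Pairing with \<open>g x\<close> undoes the \<open>sharp\<close> in the definition; what
  remains is the Koszul formula for constant fields.\<close>

lemma g_christoffel:
  assumes x: "x \<in> U"
  shows "g x (christoffel g x u v) w = (dg x u v w + dg x v u w - dg x w u v) / 2"
proof -
  have "linear (\<lambda>w. (dg x u v w + dg x v u w - dg x w u v) / 2)"
    by (rule linearI)
      (simp_all add: linear_add[OF linear_dg[OF x]] linear_scale[OF linear_dg[OF x]]
        bilinear_radd[OF bilinear_dg[OF x]] bilinear_rmul[OF bilinear_dg[OF x]] field_simps)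
  then show ?thesis
    by (simp add: christoffel_def g_sharp[OF x] covec_inner flip: dg_def)
qed

lemma christoffel_sym: "x \<in> U \<Longrightarrow> christoffel g x u v = christoffel g x v u"
  by (rule g_eqI[of x]) (simp_all add: g_christoffel dg_sym)

lemma bilinear_christoffel:
  assumes x: "x \<in> U"
  shows "bilinear (christoffel g x)"
proof -
  have "linear (christoffel g x u)" for u
    by (rule linearI; rule g_eqI[OF x])
      (simp_all add: x g_christoffel g_add_left g_scale_left field_simps
        linear_add[OF linear_dg[OF x]] linear_scale[OF linear_dg[OF x]]
        bilinear_ladd[OF bilinear_dg[OF x]] bilinear_radd[OF bilinear_dg[OF x]]
        bilinear_lmul[OF bilinear_dg[OF x]] bilinear_rmul[OF bilinear_dg[OF x]])
  moreover have "(\<lambda>u. christoffel g x u v) = christoffel g x v" for v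
    using christoffel_sym[OF x] by blast
  ultimately show ?thesis by (simp add: bilinear_def)
qed

text \<open>In the sum of the two Koszul formulas all but one derivative cancel. This is \<nabla>g =
  0 on constant fields.\<close>

lemma metric_compatible:
  "x \<in> U \<Longrightarrow> dg x w u v = g x (christoffel g x w u) v + g x u (christoffel g x w v)"
  using g_sym[of x u "christoffel g x w v"] dg_sym[of x w u v] g_christoffel[of x w u v]
    g_christoffel[of x w v u]
  by argo

text \<open>No matrix is inverted: the sharp at \<open>y\<close> solves the equation at
  \<open>x\<close> up to a perturbation that vanishes at \<open>x\<close>. This gives first
  continuity, then differentiability.\<close>

lemma sharp_differentiable:
  assumes x: "x \<in> U"
  shows "(\<lambda>y. sharp (g y) \<omega>) differentiable (at x)"
proof -
  let ?s = "\<lambda>y. sharp (g y) \<omega>"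
  define E where "E i j y = g y i j - g x i j" for i j y
  define B :: "('e \<times> 'e) set" where "B = Basis \<times> Basis"
  define T where "T j = sharp (g x) j" for j
  text \<open>Comparing the equations that define the two sharps gives a fixed point equation.\<close>
  have fix_eq: "?s y = ?s x - (\<Sum>(i, j)\<in>B. (?s y \<bullet> i) *\<^sub>R (E i j y *\<^sub>R T j))" if y: "y \<in> U" for y
  proof (rule sym, rule g_eqI[OF x])
    fix v
    have ex: "g z u v = (\<Sum>(i, j)\<in>B. (u \<bullet> i) * (g z i j * (j \<bullet> v)))" if z: "z \<in> U" for z u
    proof -
      interpret bounded_bilinear "g z" using z by (rule bounded_bilinear_g)
      have "g z u v = g z (\<Sum>i\<in>Basis. (u \<bullet> i) *\<^sub>R i) (\<Sum>j\<in>Basis. (v \<bullet> j) *\<^sub>R j)"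
        by (simp add: euclidean_representation)
      also have "\<dots> = (\<Sum>i\<in>Basis. \<Sum>j\<in>Basis. (u \<bullet> i) * (g z i j * (j \<bullet> v)))"
        unfolding sum_left
        by (simp add: sum_right scaleR_left scaleR_right sum_distrib_left inner_commute mult_ac)
      finally show ?thesis by (simp add: B_def sum.cartesian_product)
    qed
    interpret bounded_bilinear "g x" using x by (rule bounded_bilinear_g)
    have "g x (?s x - (\<Sum>(i, j)\<in>B. (?s y \<bullet> i) *\<^sub>R (E i j y *\<^sub>R T j))) v
        = \<omega> \<bullet> v - (\<Sum>(i, j)\<in>B. (?s y \<bullet> i) * (E i j y * (j \<bullet> v)))"
      by (simp add: diff_left sum_left scaleR_left T_def g_sharp x case_prod_unfold mult.assoc)
    also have "\<dots> = \<omega> \<bullet> v - (g y (?s y) v - g x (?s y) v)"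
      unfolding ex[OF x] ex[OF y]
      by (simp add: E_def sum_subtractf[symmetric] case_prod_unfold algebra_simps)
    also have "\<dots> = g x (?s y) v" by (simp add: g_sharp y)
    finally show "g x (?s x - (\<Sum>(i, j)\<in>B. (?s y \<bullet> i) *\<^sub>R (E i j y *\<^sub>R T j))) v = g x (?s y) v" .
  qed
  have E: "((\<lambda>y. E i j y *\<^sub>R T j) has_derivative (\<lambda>w. dg x w i j *\<^sub>R T j)) (at x)" for i j
    using g_differentiable[OF x] unfolding frechet_derivative_works E_def dg_def
    by (auto intro!: derivative_eq_intros)
  have E0: "E i j x = 0" for i j by (simp add: E_def)
  \<comment> \<open>\<open>\<eta> y\<close> bounds the size of the perturbation relative to
    \<open>norm (?s y)\<close>.\<close>
  define \<eta> where "\<eta> y = (\<Sum>(i, j)\<in>B. norm (E i j y *\<^sub>R T j))" for y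
  have \<eta>: "(\<eta> \<longlongrightarrow> 0) (at x)"
  proof -
    have "((\<lambda>y. E i j y *\<^sub>R T j) \<longlongrightarrow> 0) (at x)" for i j
      using has_derivative_continuous[OF E, of i j] E0 by (simp add: continuous_at)
    then have "(\<eta> \<longlongrightarrow> (\<Sum>(i, j)\<in>B. 0)) (at x)"
      unfolding \<eta>_def case_prod_unfold by (intro tendsto_sum tendsto_norm_zero)
    then show ?thesis by simp
  qed
  have evU: "\<forall>\<^sub>F y in at x. y \<in> U"
    using open_U x eventually_at_topological by blast
  have bound: "norm (?s y - ?s x) \<le> norm (?s y) * \<eta> y" if y: "y \<in> U" for y
  proof -
    have "norm (?s y - ?s x) = norm (\<Sum>(i, j)\<in>B. (?s y \<bullet> i) *\<^sub>R (E i j y *\<^sub>R T j))"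
      by (subst fix_eq[OF y]) (simp add: norm_minus_commute)
    also have "\<dots> \<le> (\<Sum>(i, j)\<in>B. norm (?s y) * norm (E i j y *\<^sub>R T j))"
      unfolding case_prod_unfold
      by (rule sum_norm_le) (auto simp: B_def abs_mult mult.assoc intro!: mult_right_mono Basis_le_norm)
    finally show ?thesis by (simp add: \<eta>_def sum_distrib_left case_prod_unfold)
  qed
  \<comment> \<open>Once \<open>\<eta> y < 1/2\<close>, half of \<open>norm (?s y)\<close> is
    absorbed on the left, so \<open>?s\<close> stays bounded near \<open>x\<close> and the
    perturbation tends to 0.\<close>
  have "isCont ?s x"
  proof -
    have "\<forall>\<^sub>F y in at x. dist (\<eta> y) 0 < 1/2"
      using \<eta> by (rule tendstoD) simp
    then have "\<forall>\<^sub>F y in at x. norm (?s y - ?s x) \<le> 2 * norm (?s x) * \<eta> y"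
      using evU
    proof eventually_elim
      case (elim y)
      have \<eta>0: "\<eta> y \<ge> 0" unfolding \<eta>_def by (intro sum_nonneg) auto
      have "norm (?s y) \<le> norm (?s x) + norm (?s y) * \<eta> y"
        using bound[OF elim(2)] norm_triangle_ineq2[of "?s y" "?s x"] by linarith
      also have "norm (?s y) * \<eta> y \<le> norm (?s y) * (1/2)"
        using elim(1) \<eta>0 by (intro mult_left_mono) (auto simp: dist_real_def)
      finally have "norm (?s y) \<le> 2 * norm (?s x)" by simp
      with bound[OF elim(2)] \<eta>0 show ?case by (meson mult_right_mono order_trans)
    qed
    moreover have "((\<lambda>y. 2 * norm (?s x) * \<eta> y) \<longlongrightarrow> 0) (at x)"
      using tendsto_mult_right_zero[OF \<eta>] .
    ultimately have "((\<lambda>y. ?s y - ?s x) \<longlongrightarrow> 0) (at x)"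
      by (rule Lim_null_comparison)
    then show ?thesis by (simp add: isCont_def LIM_zero_iff)
  qed
  \<comment> \<open>Each summand is a vanishing term \<open>E i j y *\<^sub>R T j\<close> times a
    factor \<open>?s y \<bullet> i\<close> so far known only to be continuous.\<close>
  have "((\<lambda>y. ?s x - (\<Sum>p\<in>B. (?s y \<bullet> fst p) *\<^sub>R (E (fst p) (snd p) y *\<^sub>R T (snd p)))) has_derivative
      (\<lambda>w. 0 - (\<Sum>p\<in>B. (?s x \<bullet> fst p) *\<^sub>R (dg x w (fst p) (snd p) *\<^sub>R T (snd p))))) (at x)"
    using \<open>isCont ?s x\<close>
    by (intro has_derivative_diff has_derivative_const has_derivative_sum
        has_derivative_scaleR_vanishing[OF E]) (auto simp: E0)
  then have "(?s has_derivative
      (\<lambda>w. 0 - (\<Sum>p\<in>B. (?s x \<bullet> fst p) *\<^sub>R (dg x w (fst p) (snd p) *\<^sub>R T (snd p))))) (at x)"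
    by (rule has_derivative_transform_within_open[OF _ open_U x])
      (use fix_eq in \<open>simp add: case_prod_unfold\<close>)
  then show ?thesis by (rule differentiableI)
qed

end

text \<open>The second derivatives of \<open>g\<close> make the Christoffel symbols differentiable,
  as curvature requires.\<close>

locale riemannian_chart = metric_chart U g
  for U :: "'e::euclidean_space set" and g +
  assumes dg_differentiable: "x \<in> U \<Longrightarrow> (\<lambda>y. dg y w u v) differentiable (at x)"
begin

lemma christoffel_differentiable:
  assumes x: "x \<in> U"
  shows "(\<lambda>y. christoffel g y u v) differentiable (at x)"
proof -
  let ?a = "\<lambda>y. covec (\<lambda>w. (dg y u v w + dg y v u w - dg y w u v) / 2)"
  have "(?a has_derivative frechet_derivative ?a (at x)) (at x)"
    unfolding covec_def frechet_derivative_works[symmetric]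
    using dg_differentiable[OF x] by (intro differentiable_sum ballI derivative_intros) auto
  from has_derivative_linear_family[where X = "\<lambda>y. y", OF open_U x linear_sharp
      sharp_differentiable[OF x] has_derivative_ident this]
  show ?thesis by (simp add: christoffel_def dg_def[abs_def] differentiableI)
qed

definition dchr :: "'e \<Rightarrow> 'e \<Rightarrow> 'e \<Rightarrow> 'e \<Rightarrow> 'e" where
  "dchr x w u v = frechet_derivative (\<lambda>y. christoffel g y u v) (at x) w"

lemma bilinear_dchr: "x \<in> U \<Longrightarrow> bilinear (dchr x w)"
  unfolding dchr_def[abs_def] using open_U bilinear_christoffel christoffel_differentiable
  by (intro bilinear_frechet_derivative_family)

lemma linear_dchr: "x \<in> U \<Longrightarrow> linear (\<lambda>w. dchr x w u v)"
  unfolding dchr_def using linear_frechet_derivative[OF christoffel_differentiable] .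

lemma dchr_sym: "x \<in> U \<Longrightarrow> dchr x w u v = dchr x w v u"
  unfolding dchr_def
  by (rule fun_cong[OF frechet_derivative_eqI])
    (rule has_derivative_transform_within_open[OF
        christoffel_differentiable[unfolded frechet_derivative_works] open_U],
      auto simp: christoffel_sym)

section \<open>Covariant product rules\<close>

lemma has_derivative_christoffel:
  assumes "X z \<in> U" "(X has_derivative X') (at z)" "(a has_derivative a') (at z)"
    "(b has_derivative b') (at z)"
  shows "((\<lambda>z. christoffel g (X z) (a z) (b z)) has_derivative
    (\<lambda>h. dchr (X z) (X' h) (a z) (b z) + christoffel g (X z) (a' h) (b z)
       + christoffel g (X z) (a z) (b' h))) (at z)"
  unfolding dchr_def
  by (rule has_derivative_bilinear_family[OF open_U]) (use assms bilinear_christoffel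
      christoffel_differentiable in auto)

text \<open>By \<open>metric_compatible\<close>, the derivative of the coefficients becomes a
  connection term on each argument: the covariant product rule along \<open>X\<close>.\<close>

lemma has_derivative_g:
  assumes "X z \<in> U" "(X has_derivative X') (at z)" "(a has_derivative a') (at z)"
    "(b has_derivative b') (at z)"
  shows "((\<lambda>z. g (X z) (a z) (b z)) has_derivative
    (\<lambda>h. g (X z) (a' h + christoffel g (X z) (X' h) (a z)) (b z)
       + g (X z) (a z) (b' h + christoffel g (X z) (X' h) (b z)))) (at z)"
  by (rule has_derivative_eq_rhs, rule has_derivative_bilinear_family[OF open_U])
    (use assms bilinear_g g_differentiable in
      \<open>auto simp: fun_eq_iff g_add_left g_add_right metric_compatible simp flip: dg_def\<close>)

text \<open>The endomorphism \<open>\<omega> \<mapsto> \<omega>\<^sub>h \<Gamma>\<^sup>h\<^sub>i\<^sub>j u\<^sup>j\<close> by which covectors are differentiated covariantly.\<close>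

definition cochr :: "'e \<Rightarrow> 'e \<Rightarrow> 'e \<Rightarrow> 'e" where
  "cochr x u \<omega> = covec (\<lambda>v. \<omega> \<bullet> christoffel g x v u)"

lemma cochr_inner:
  assumes "x \<in> U"
  shows "cochr x u \<omega> \<bullet> v = \<omega> \<bullet> christoffel g x u v"
proof -
  have "linear (\<lambda>v. \<omega> \<bullet> christoffel g x v u)"
    by (rule linearI) (simp_all add: bilinear_ladd[OF bilinear_christoffel[OF assms]]
        bilinear_lmul[OF bilinear_christoffel[OF assms]] inner_add_right)
  then show ?thesis
    by (simp add: cochr_def covec_inner christoffel_sym[OF assms, of v])
qed

text \<open>Raising an index commutes with covariant differentiation. To see this, the defining
  relation of the sharp, paired with a fixed \<open>v\<close>, is differentiated and compared with
  \<open>has_derivative_g\<close>.\<close>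

lemma has_derivative_sharp:
  assumes U: "X z \<in> U" and X: "(X has_derivative X') (at z)" and \<omega>: "(\<omega> has_derivative \<omega>') (at z)"
  shows "((\<lambda>z. sharp (g (X z)) (\<omega> z)) has_derivative
    (\<lambda>h. sharp (g (X z)) (\<omega>' h - cochr (X z) (X' h) (\<omega> z))
       - christoffel g (X z) (X' h) (sharp (g (X z)) (\<omega> z)))) (at z)"
proof -
  let ?s = "\<lambda>z. sharp (g (X z)) (\<omega> z)"
  obtain s' where s': "(?s has_derivative s') (at z)"
    using has_derivative_linear_family[OF open_U U linear_sharp sharp_differentiable[OF U] X \<omega>] by blast
  have eq: "s' h + christoffel g (X z) (X' h) (?s z) = sharp (g (X z)) (\<omega>' h - cochr (X z) (X' h) (\<omega> z))"
    for h
  proof (rule g_eqI[OF U])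
    fix v
    have "((\<lambda>z. g (X z) (?s z) v) has_derivative (\<lambda>h. \<omega>' h \<bullet> v)) (at z)"
    proof (rule has_derivative_transform_eventually)
      show "\<forall>\<^sub>F w in at z. \<omega> w \<bullet> v = g (X w) (?s w) v"
        using topological_tendstoD[OF has_derivative_continuous[OF X, unfolded continuous_at] open_U U]
        by eventually_elim (simp add: g_sharp)
    qed (auto simp: g_sharp U intro!: has_derivative_inner_left \<omega>)
    from has_derivative_unique[OF this has_derivative_g[OF U X s' has_derivative_const]]
    have "\<omega>' h \<bullet> v = g (X z) (s' h + christoffel g (X z) (X' h) (?s z)) v
        + g (X z) (?s z) (christoffel g (X z) (X' h) v)"
      by (simp add: fun_eq_iff)
    then show "g (X z) (s' h + christoffel g (X z) (X' h) (?s z)) v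
        = g (X z) (sharp (g (X z)) (\<omega>' h - cochr (X z) (X' h) (\<omega> z))) v"
      by (simp add: g_sharp U inner_diff_left cochr_inner)
  qed
  show ?thesis
    using s' by (rule has_derivative_eq_rhs) (simp add: fun_eq_iff flip: eq)
qed

lemma has_derivative_cometric:
  assumes U: "X z \<in> U" and X: "(X has_derivative X') (at z)"
    and \<alpha>: "(\<alpha> has_derivative \<alpha>') (at z)" and \<beta>: "(\<beta> has_derivative \<beta>') (at z)"
  shows "((\<lambda>z. cometric (g (X z)) (\<alpha> z) (\<beta> z)) has_derivative
    (\<lambda>h. cometric (g (X z)) (\<alpha>' h - cochr (X z) (X' h) (\<alpha> z)) (\<beta> z)
       + cometric (g (X z)) (\<alpha> z) (\<beta>' h - cochr (X z) (X' h) (\<beta> z)))) (at z)"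
  unfolding cometric_def
  by (rule has_derivative_eq_rhs[OF has_derivative_g[OF U X has_derivative_sharp[OF U X \<alpha>]
        has_derivative_sharp[OF U X \<beta>]]]) simp

lemma has_derivative_cochr:
  assumes U: "X z \<in> U" and X: "(X has_derivative X') (at z)"
    and u: "(u has_derivative u') (at z)" and \<omega>: "(\<omega> has_derivative \<omega>') (at z)"
  shows "((\<lambda>z. cochr (X z) (u z) (\<omega> z)) has_derivative
    (\<lambda>h. cochr (X z) (u z) (\<omega>' h) + cochr (X z) (u' h) (\<omega> z)
       + covec (\<lambda>v. \<omega> z \<bullet> dchr (X z) (X' h) v (u z)))) (at z)"
proof (rule has_derivative_eq_rhs)
  show "((\<lambda>z. cochr (X z) (u z) (\<omega> z)) has_derivative
    (\<lambda>h. \<Sum>b\<in>Basis. (\<omega> z \<bullet> (dchr (X z) (X' h) b (u z) + christoffel g (X z) 0 (u z)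
       + christoffel g (X z) b (u' h)) + \<omega>' h \<bullet> christoffel g (X z) b (u z)) *\<^sub>R b)) (at z)"
    unfolding cochr_def covec_def
    by (intro has_derivative_sum has_derivative_scaleR_left has_derivative_inner \<omega>
        has_derivative_christoffel U X u has_derivative_const)
qed (simp add: fun_eq_iff cochr_def covec_def sum.distrib[symmetric]
    bilinear_lzero[OF bilinear_christoffel[OF U]] algebra_simps)

subsection \<open>Curvature\<close>

text \<open>Constant fields have zero bracket and zero derivative, which leaves the classical
  coordinate formula.\<close>

lemma curvature_eq:
  assumes x: "x \<in> U"
  shows "curvature g x u v w = dchr x u v w - dchr x v u w
    + christoffel g x u (christoffel g x v w) - christoffel g x v (christoffel g x u w)"
  by (simp add: curvature_def curvature_field_def nabla_def[abs_def] lie_bracket_def dchr_def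
      bilinear_lzero[OF bilinear_christoffel[OF x]])

lemma linear_curvature_left:
  assumes x: "x \<in> U"
  shows "linear (\<lambda>u. curvature g x u v w)"
  by (rule linearI)
    (simp_all add: curvature_eq[OF x] linear_add[OF linear_dchr[OF x]] linear_scale[OF linear_dchr[OF x]]
      bilinear_ladd[OF bilinear_dchr[OF x]] bilinear_lmul[OF bilinear_dchr[OF x]]
      bilinear_ladd[OF bilinear_christoffel[OF x]] bilinear_lmul[OF bilinear_christoffel[OF x]]
      bilinear_radd[OF bilinear_christoffel[OF x]] bilinear_rmul[OF bilinear_christoffel[OF x]] algebra_simps)

lemma curvature_antisym: "x \<in> U \<Longrightarrow> curvature g x u v w = - curvature g x v u w"
  by (simp add: curvature_eq)

text \<open>Torsion-freeness, that is symmetry of the Christoffel symbols and of their derivatives,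
  makes the terms cancel in pairs.\<close>

lemma bianchi:
  "x \<in> U \<Longrightarrow> curvature g x u v w + curvature g x v w u + curvature g x w u v = 0"
  using christoffel_sym[of x u v] christoffel_sym[of x v w] christoffel_sym[of x w u]
    dchr_sym[of x u v w] dchr_sym[of x v w u] dchr_sym[of x w u v]
  by (simp add: curvature_eq)

text \<open>Differentiating \<open>metric_compatible\<close> expresses the second derivatives of
  \<open>g\<close>. These commute, and the products of two Christoffel terms are jointly symmetric
  in \<open>u\<close> and \<open>v\<close>, so only the two curvature terms survive.\<close>

lemma curvature_skew:
  assumes x: "x \<in> U"
  shows "g x (curvature g x u v w) z = - g x w (curvature g x u v z)"
proof -
  let ?\<Gamma> = "christoffel g x"
  have D: "frechet_derivative (\<lambda>y. dg y v w z) (at x) u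
      = g x (dchr x u v w + ?\<Gamma> u (?\<Gamma> v w)) z + g x (?\<Gamma> v w) (?\<Gamma> u z)
      + g x (?\<Gamma> u w) (?\<Gamma> v z) + g x w (dchr x u v z + ?\<Gamma> u (?\<Gamma> v z))" for u v
  proof -
    have \<Gamma>: "((\<lambda>y. christoffel g y v w) has_derivative (\<lambda>u. dchr x u v w)) (at x)" for w
      using christoffel_differentiable[OF x] by (simp add: frechet_derivative_works dchr_def[abs_def])
    note id = has_derivative_ident[where F = "at x"]
    have "((\<lambda>y. g y (christoffel g y v w) z + g y w (christoffel g y v z)) has_derivative
      (\<lambda>u. (g x (dchr x u v w + ?\<Gamma> u (?\<Gamma> v w)) z + g x (?\<Gamma> v w) (0 + ?\<Gamma> u z))
      + (g x (0 + ?\<Gamma> u w) (?\<Gamma> v z) + g x w (dchr x u v z + ?\<Gamma> u (?\<Gamma> v z))))) (at x)"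
      by (rule has_derivative_add[OF has_derivative_g[OF x id \<Gamma> has_derivative_const]
            has_derivative_g[OF x id has_derivative_const \<Gamma>]])
    then have "((\<lambda>y. dg y v w z) has_derivative
      (\<lambda>u. (g x (dchr x u v w + ?\<Gamma> u (?\<Gamma> v w)) z + g x (?\<Gamma> v w) (0 + ?\<Gamma> u z))
      + (g x (0 + ?\<Gamma> u w) (?\<Gamma> v z) + g x w (dchr x u v z + ?\<Gamma> u (?\<Gamma> v z))))) (at x)"
      by (rule has_derivative_transform_within_open[OF _ open_U x]) (simp add: metric_compatible)
    then show ?thesis by (simp add: frechet_derivative_eqI)
  qed
  have "frechet_derivative (\<lambda>y. dg y v w z) (at x) u = frechet_derivative (\<lambda>y. dg y u w z) (at x) v"
    unfolding dg_def
    using second_derivative_symmetric[OF open_U x g_differentiable dg_differentiable[OF x, unfolded dg_def]] .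
  then show ?thesis
    unfolding D curvature_eq[OF x] by (simp add: x g_add_left g_add_right g_diff_left g_diff_right)
qed

text \<open>The classical octahedron argument: four instances of the Bianchi identity are combined
  linearly, using skewness in the first pair and in the last pair.\<close>

lemma curvature_pair_sym:
  assumes x: "x \<in> U"
  shows "g x (curvature g x a b c) d = g x (curvature g x c d a) b"
proof -
  define f where "f a b c d = g x (curvature g x a b c) d" for a b c d
  have f1: "f a b c d = - f b a c d" for a b c d
    unfolding f_def using curvature_antisym[OF x] g_neg_left[OF x] by metis
  have f2: "f a b c d = - f a b d c" for a b c d
    unfolding f_def using curvature_skew[OF x] g_sym[OF x] by metis
  have f3: "f a b c d + f b c a d + f c a b d = 0" for a b c d
    unfolding f_def
    by (simp add: x bianchi bilinear_lzero[OF bilinear_g[OF x]] flip: g_add_left)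
  show ?thesis
    using f3[of a b c d] f3[of b c d a] f3[of c d a b] f3[of d a b c]
      f1[of a b c d] f1[of b c a d] f1[of c a b d] f1[of b c d a] f1[of c d b a] f1[of d b c a]
      f1[of c d a b] f1[of d a c b] f1[of a c d b] f1[of d a b c] f1[of a b d c] f1[of b d a c]
      f2[of a b c d] f2[of b c a d] f2[of c a b d] f2[of b c d a] f2[of c d b a] f2[of d b c a]
      f2[of c d a b] f2[of d a c b] f2[of a c d b] f2[of d a b c] f2[of a b d c] f2[of b d a c]
    unfolding f_def[symmetric] by linarith
qed

end

section \<open>The Berger-type deformed Sasaki metric in a chart\<close>

text \<open>\<open>J_parallel\<close> is \<nabla>J = 0 tested on fields with constant
  coordinates.\<close>

locale kaehler_chart = riemannian_chart U g
  for U :: "'e::euclidean_space set" and g +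
  fixes J :: "'e \<Rightarrow> 'e \<Rightarrow> 'e"
  assumes linear_J: "x \<in> U \<Longrightarrow> linear (J x)"
    and J_J: "x \<in> U \<Longrightarrow> J x (J x u) = - u"
    and J_isometry: "x \<in> U \<Longrightarrow> g x (J x u) (J x v) = g x u v"
    and J_differentiable: "x \<in> U \<Longrightarrow> (\<lambda>y. J y u) differentiable (at x)"
    and J_parallel: "x \<in> U \<Longrightarrow> frechet_derivative (\<lambda>y. J y v) (at x) u + christoffel g x u (J x v)
      = J x (christoffel g x u v)"
begin

lemma covec_J_inner:
  assumes "x \<in> U"
  shows "covec_J (J x) \<omega> \<bullet> v = \<omega> \<bullet> J x v"
proof -
  have "linear (\<lambda>v. \<omega> \<bullet> J x v)"
    by (rule linearI) (simp_all add: linear_add[OF linear_J[OF assms]] linear_scale[OF linear_J[OF assms]]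
        inner_add_right)
  then show ?thesis by (simp add: covec_J_def covec_inner)
qed

text \<open>An isometry with square -1 is skew-adjoint; moving \<open>J\<close> to the other
  argument of \<open>g\<close> produces the minus sign.\<close>

lemma sharp_covec_J:
  assumes x: "x \<in> U"
  shows "sharp (g x) (covec_J (J x) \<omega>) = - J x (sharp (g x) \<omega>)"
proof (rule sharp_unique[OF x])
  fix v
  have "g x (J x (sharp (g x) \<omega>)) (J x (J x v)) = g x (sharp (g x) \<omega>) (J x v)"
    using x by (rule J_isometry)
  then show "g x (- J x (sharp (g x) \<omega>)) v = covec_J (J x) \<omega> \<bullet> v"
    by (simp add: x J_J covec_J_inner g_neg_left g_neg_right g_sharp)
qed

lemma cometric_covec_J_covec_J:
  "x \<in> U \<Longrightarrow> cometric (g x) (covec_J (J x) \<alpha>) (covec_J (J x) \<beta>) = cometric (g x) \<alpha> \<beta>"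
  by (simp add: cometric_def sharp_covec_J g_neg_left g_neg_right J_isometry)

lemma covec_J_covec_J: "x \<in> U \<Longrightarrow> covec_J (J x) (covec_J (J x) \<omega>) = - \<omega>"
  by (rule inner_eqI) (simp add: covec_J_inner J_J)

lemmas cometric_add_left = bilinear_ladd[OF bilinear_cometric]
  and cometric_add_right = bilinear_radd[OF bilinear_cometric]
  and cometric_diff_left = bilinear_lsub[OF bilinear_cometric]
  and cometric_neg_right = bilinear_rneg[OF bilinear_cometric]
  and cometric_scale_left = bilinear_lmul[OF bilinear_cometric, unfolded real_scaleR_def]
  and cometric_scale_right = bilinear_rmul[OF bilinear_cometric, unfolded real_scaleR_def]
  and cometric_zero_left = bilinear_lzero[OF bilinear_cometric]
  and cometric_zero_right = bilinear_rzero[OF bilinear_cometric]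

lemma cometric_covec_J_left:
  assumes "x \<in> U"
  shows "cometric (g x) (covec_J (J x) \<alpha>) \<beta> = - cometric (g x) \<alpha> (covec_J (J x) \<beta>)"
  using cometric_covec_J_covec_J[OF assms, of \<alpha> "covec_J (J x) \<beta>"]
  by (simp add: assms covec_J_covec_J cometric_neg_right)

lemma cometric_covec_J_self: "x \<in> U \<Longrightarrow> cometric (g x) \<omega> (covec_J (J x) \<omega>) = 0"
  using cometric_covec_J_left[of x \<omega> \<omega>] cometric_sym[of x \<omega> "covec_J (J x) \<omega>"] by linarith

text \<open>Since \<open>J\<close> is parallel, \<open>\<omega> \<mapsto> \<omega>J\<close> commutes with covariant differentiation.\<close>

lemma has_derivative_covec_J:
  assumes U: "X z \<in> U" and X: "(X has_derivative X') (at z)" and \<omega>: "(\<omega> has_derivative \<omega>') (at z)"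
  shows "((\<lambda>z. covec_J (J (X z)) (\<omega> z)) has_derivative
    (\<lambda>h. covec_J (J (X z)) (\<omega>' h - cochr (X z) (X' h) (\<omega> z))
       + cochr (X z) (X' h) (covec_J (J (X z)) (\<omega> z)))) (at z)"
proof (rule has_derivative_eq_rhs)
  let ?D = "\<lambda>h. covec (\<lambda>b. \<omega> z \<bullet> (frechet_derivative (\<lambda>y. J y b) (at (X z)) (X' h) + J (X z) 0)
       + \<omega>' h \<bullet> J (X z) b)"
  show "((\<lambda>z. covec_J (J (X z)) (\<omega> z)) has_derivative ?D) (at z)"
    unfolding covec_J_def covec_def
    by (intro has_derivative_sum has_derivative_scaleR_left has_derivative_inner \<omega>
        has_derivative_linear_family[where F = J, OF open_U _ linear_J J_differentiable] U X has_derivative_const)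
  have par: "frechet_derivative (\<lambda>y. J y v) (at (X z)) h
      = J (X z) (christoffel g (X z) h v) - christoffel g (X z) h (J (X z) v)" for v h
    using J_parallel[OF U, of v h] by (simp add: eq_diff_eq)
  show "?D = (\<lambda>h. covec_J (J (X z)) (\<omega>' h - cochr (X z) (X' h) (\<omega> z))
       + cochr (X z) (X' h) (covec_J (J (X z)) (\<omega> z)))"
  proof (rule ext, rule inner_eqI)
    fix h v
    have "?D h = covec (\<lambda>b. \<omega> z \<bullet> (J (X z) (christoffel g (X z) (X' h) b)
        - christoffel g (X z) (X' h) (J (X z) b)) + \<omega>' h \<bullet> J (X z) b)"
      by (simp add: par linear_0[OF linear_J[OF U]])
    also have "\<dots> \<bullet> v = \<omega> z \<bullet> (J (X z) (christoffel g (X z) (X' h) v)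
        - christoffel g (X z) (X' h) (J (X z) v)) + \<omega>' h \<bullet> J (X z) v"
      by (intro covec_inner linearI)
        (simp_all add: linear_add[OF linear_J[OF U]] linear_scale[OF linear_J[OF U]]
          bilinear_radd[OF bilinear_christoffel[OF U]] bilinear_rmul[OF bilinear_christoffel[OF U]]
          inner_add_right inner_diff_right algebra_simps)
    finally show "?D h \<bullet> v = (covec_J (J (X z)) (\<omega>' h - cochr (X z) (X' h) (\<omega> z))
       + cochr (X z) (X' h) (covec_J (J (X z)) (\<omega> z))) \<bullet> v"
      by (simp add: U covec_J_inner cochr_inner inner_add_left inner_diff_left inner_diff_right)
  qed
qed

section \<open>The bundle metric and its first derivatives\<close>

text \<open>The coordinate form of \<open>berger_sasaki\<close> in a single chart, free of chart
  indices so that it can instantiate \<open>metric_chart\<close>.\<close>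

definition bs :: "real \<Rightarrow> 'e \<times> 'e \<Rightarrow> 'e \<times> 'e \<Rightarrow> 'e \<times> 'e \<Rightarrow> real" where
  "bs \<delta> z \<xi> \<eta> = g (fst z) (fst \<xi>) (fst \<eta>)
     + (cometric (g (fst z)) (vpart g z \<xi>) (vpart g z \<eta>)
     + \<delta>\<^sup>2 * cometric (g (fst z)) (vpart g z \<xi>) (covec_J (J (fst z)) (snd z))
          * cometric (g (fst z)) (vpart g z \<eta>) (covec_J (J (fst z)) (snd z)))"

text \<open>The fibre component of a horizontal lift is \<open>cochr\<close>; hence the vertical
  part of the velocity of a curve is the covariant derivative of its covector.\<close>

lemma vpart_eq: "vpart g z \<xi> = snd \<xi> - cochr (fst z) (fst \<xi>) (snd z)"
  by (simp add: vpart_def hlift_def cochr_def case_prod_unfold)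

lemma cochr_add: "x \<in> U \<Longrightarrow> cochr x (u + v) \<omega> = cochr x u \<omega> + cochr x v \<omega>"
  and cochr_scale: "x \<in> U \<Longrightarrow> cochr x (c *\<^sub>R u) \<omega> = c *\<^sub>R cochr x u \<omega>"
  and cochr_zero: "x \<in> U \<Longrightarrow> cochr x 0 \<omega> = 0"
  by (rule inner_eqI; simp add: cochr_inner inner_add_left bilinear_ladd[OF bilinear_christoffel]
      bilinear_lmul[OF bilinear_christoffel] bilinear_lzero[OF bilinear_christoffel] inner_add_right)+

lemma linear_vpart: "fst z \<in> U \<Longrightarrow> linear (vpart g z)"
  by (rule linearI) (simp_all add: vpart_eq cochr_add cochr_scale algebra_simps)

text \<open>The covariant derivative of the vertical part of the constant field \<open>\<xi>\<close> in direction \<open>w\<close>.\<close>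

definition dvpart :: "'e \<times> 'e \<Rightarrow> 'e \<times> 'e \<Rightarrow> 'e \<times> 'e \<Rightarrow> 'e" where
  "dvpart z w \<xi> = - cochr (fst z) (fst \<xi>) (snd w)
     - covec (\<lambda>v. snd z \<bullet> dchr (fst z) (fst w) v (fst \<xi>)) - cochr (fst z) (fst w) (vpart g z \<xi>)"

text \<open>The last term is the connection term that \<open>has_derivative_cometric\<close>
  subtracts again; the other two form the covariant derivative.\<close>

lemma has_derivative_vpart:
  assumes z: "fst (Z t) \<in> U" and Z: "(Z has_derivative Z') (at t)" and \<xi>: "(\<xi> has_derivative \<xi>') (at t)"
  shows "((\<lambda>t. vpart g (Z t) (\<xi> t)) has_derivative
    (\<lambda>h. vpart g (Z t) (\<xi>' h) + dvpart (Z t) (Z' h) (\<xi> t)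
      + cochr (fst (Z t)) (fst (Z' h)) (vpart g (Z t) (\<xi> t)))) (at t)"
  unfolding vpart_eq
  by (rule has_derivative_eq_rhs, rule has_derivative_diff[OF has_derivative_snd[OF \<xi>]
        has_derivative_cochr[OF z has_derivative_fst[OF Z] has_derivative_fst[OF \<xi>]
          has_derivative_snd[OF Z]]])
    (simp add: fun_eq_iff dvpart_def vpart_eq)

text \<open>This is the Ricci identity, through which curvature enters. The terms in
  \<open>snd \<xi>\<close> and \<open>snd \<eta>\<close> are jointly symmetric and cancel, leaving
  the curvature acting on the momentum \<open>snd z\<close>.\<close>

lemma dvpart_commutator:
  assumes z: "fst z \<in> U"
  shows "(dvpart z \<xi> \<eta> - dvpart z \<eta> \<xi>) \<bullet> v = snd z \<bullet> curvature g (fst z) (fst \<eta>) (fst \<xi>) v"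
proof -
  have "linear (\<lambda>v. snd z \<bullet> dchr (fst z) w v u)" for w u
    by (rule linearI) (simp_all add: inner_add_right bilinear_ladd[OF bilinear_dchr[OF z]]
        bilinear_lmul[OF bilinear_dchr[OF z]])
  note covec_inner[OF this, of w u v for w u]
  then have "covec (\<lambda>v. snd z \<bullet> dchr (fst z) w v u) \<bullet> v = snd z \<bullet> dchr (fst z) w u v" for w u
    using dchr_sym[OF z] by metis
  then show ?thesis
    by (simp add: dvpart_def curvature_eq z cochr_inner vpart_eq inner_diff_left inner_add_left
        inner_diff_right inner_add_right)
qed

text \<open>As \<open>g\<close> and \<open>J\<close> are parallel, the product rule involves only
  covariant derivatives: those of the vertical parts are \<open>dvpart\<close>, and that of the
  momentum in direction \<open>w\<close> is \<open>vpart g z w\<close>.\<close>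

lemma has_derivative_bs:
  assumes z: "fst z \<in> U"
  shows "((\<lambda>z. bs \<delta> z \<xi> \<eta>) has_derivative
    (\<lambda>w. let x = fst z; \<alpha> = vpart g z \<xi>; \<beta> = vpart g z \<eta>; \<alpha>' = dvpart z w \<xi>; \<beta>' = dvpart z w \<eta>;
        pJ = covec_J (J x) (snd z); wJ = covec_J (J x) (vpart g z w); c = cometric (g x) in
      g x (christoffel g x (fst w) (fst \<xi>)) (fst \<eta>) + g x (fst \<xi>) (christoffel g x (fst w) (fst \<eta>))
      + (c \<alpha>' \<beta> + c \<alpha> \<beta>'
      + \<delta>\<^sup>2 * ((c \<alpha>' pJ + c \<alpha> wJ) * c \<beta> pJ + c \<alpha> pJ * (c \<beta>' pJ + c \<beta> wJ))))) (at z)"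
proof -
  have id: "((\<lambda>z. z) has_derivative (\<lambda>w. w)) (at z)" by (rule has_derivative_ident)
  note fst = has_derivative_fst[OF id] and snd = has_derivative_snd[OF id]
  note v = has_derivative_vpart[OF z id has_derivative_const]
  note J = has_derivative_covec_J[OF z fst snd]
  note c = has_derivative_cometric[OF z fst]
  have v0: "vpart g z 0 = 0" by (rule linear_0[OF linear_vpart[OF z]])
  show ?thesis
    unfolding bs_def Let_def
    by (rule has_derivative_eq_rhs[OF has_derivative_add[OF
          has_derivative_g[OF z fst has_derivative_const has_derivative_const]
          has_derivative_add[OF c[OF v v] has_derivative_mult[OF
            has_derivative_mult[OF has_derivative_const c[OF v J]] c[OF v J]]]]])
      (simp add: fun_eq_iff v0 vpart_eq[of z w for w] cochr_zero[OF z] algebra_simps)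
qed

text \<open>The Berger term is a nonnegative multiple of a square, so positivity comes from the
  horizontal and vertical inner products. The Koszul formula thereby becomes available on the
  bundle.\<close>

lemma metric_chart_bs: "metric_chart (U \<times> UNIV) (bs \<delta>)"
proof
  show "open (U \<times> (UNIV :: 'e set))"
    using open_U by (rule open_Times) simp
next
  fix z :: "'e \<times> 'e" assume "z \<in> U \<times> UNIV"
  then have z: "fst z \<in> U" by auto
  note v = linear_add[OF linear_vpart[OF z]] linear_scale[OF linear_vpart[OF z]]
  show "bilinear (bs \<delta> z)"
    unfolding bilinear_def
    by (intro conjI allI linearI)
      (simp_all add: bs_def v z g_add_left g_add_right g_scale_left g_scale_right
        cometric_add_left cometric_add_right cometric_scale_left cometric_scale_right algebra_simps)
  show "bs \<delta> z \<xi> \<eta> = bs \<delta> z \<eta> \<xi>" for \<xi> \<eta>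
    unfolding bs_def
    by (simp add: g_sym[OF z, of "fst \<xi>" "fst \<eta>"] cometric_sym[OF z, of "vpart g z \<xi>" "vpart g z \<eta>"])
  show "bs \<delta> z \<xi> \<xi> > 0" if "\<xi> \<noteq> 0" for \<xi>
  proof -
    have nonneg: "g (fst z) (fst \<xi>) (fst \<xi>) \<ge> 0" "cometric (g (fst z)) (vpart g z \<xi>) (vpart g z \<xi>) \<ge> 0"
      using g_pos[OF z, of "fst \<xi>"] cometric_pos[OF z, of "vpart g z \<xi>"]
      by (cases "fst \<xi> = 0"; cases "vpart g z \<xi> = 0";
          simp add: bilinear_lzero[OF bilinear_g[OF z]] cometric_zero_left[OF z] less_imp_le)+
    \<comment> \<open>If \<open>fst \<xi>\<close> is 0, the vertical part is
      \<open>snd \<xi>\<close> itself.\<close>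
    have "fst \<xi> \<noteq> 0 \<or> vpart g z \<xi> \<noteq> 0"
      using that by (auto simp: vpart_eq cochr_zero[OF z] prod_eq_iff)
    then have "g (fst z) (fst \<xi>) (fst \<xi>) + cometric (g (fst z)) (vpart g z \<xi>) (vpart g z \<xi>) > 0"
      using nonneg g_pos[OF z, of "fst \<xi>"] cometric_pos[OF z, of "vpart g z \<xi>"]
      by (auto intro: add_pos_nonneg add_nonneg_pos)
    moreover have "\<delta>\<^sup>2 * cometric (g (fst z)) (vpart g z \<xi>) (covec_J (J (fst z)) (snd z))
        * cometric (g (fst z)) (vpart g z \<xi>) (covec_J (J (fst z)) (snd z)) \<ge> 0"
      by (simp add: mult.assoc)
    ultimately show ?thesis unfolding bs_def by linarith
  qed
  show "(\<lambda>y. bs \<delta> y \<xi> \<eta>) differentiable (at z)" for \<xi> \<eta>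
    using has_derivative_bs[OF z] by (rule differentiableI)
qed

text \<open>
  The Euler--Lagrange expression in direction \<open>\<eta>\<close>. As \<open>fst \<eta>\<close> and the
  vertical part of \<open>\<eta>\<close> are independent, its vanishing splits into a horizontal and a vertical equation.
\<close>

lemma acceleration_bs:
  fixes z \<zeta> a \<eta> :: "'e \<times> 'e" and \<delta> :: real
  assumes z: "fst z \<in> U"
  defines "x \<equiv> fst z" and "p \<equiv> snd z"
  defines "pJ \<equiv> covec_J (J x) p" and "\<alpha> \<equiv> vpart g z \<zeta>"
  defines "k \<equiv> \<delta>\<^sup>2 * cometric (g x) \<alpha> pJ"
  defines "x'' \<equiv> fst a + christoffel g x (fst \<zeta>) (fst \<zeta>)" and "p'' \<equiv> vpart g z a + dvpart z \<zeta> \<zeta>"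
  shows "bs \<delta> z (a + christoffel (bs \<delta>) z \<zeta> \<zeta>) \<eta> =
    g x (x'' - curvature g x (sharp (g x) (\<alpha> + k *\<^sub>R pJ)) (sharp (g x) p) (fst \<zeta>)) (fst \<eta>)
    + cometric (g x) (vpart g z \<eta>)
        (p'' + (\<delta>\<^sup>2 * cometric (g x) p'' pJ) *\<^sub>R pJ + (2 * k) *\<^sub>R covec_J (J x) \<alpha>)"
proof -
  interpret cot: metric_chart "U \<times> UNIV" "bs \<delta>" by (rule metric_chart_bs)
  have zU: "z \<in> U \<times> UNIV" and x: "x \<in> U" using z by (auto simp: x_def mem_Times_iff)
  define \<beta> where "\<beta> = vpart g z \<eta>"
  define c where "c = cometric (g x)"
  note c_simps = cometric_add_left[OF x, folded c_def] cometric_add_right[OF x, folded c_def]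
    cometric_diff_left[OF x, folded c_def] cometric_scale_left[OF x, folded c_def]
    cometric_scale_right[OF x, folded c_def]
  note dbs = frechet_derivative_eqI[OF has_derivative_bs[OF z], of \<delta>, unfolded Let_def,
      folded x_def p_def, folded pJ_def, folded c_def]
  \<comment> \<open>The covariant derivative of \<open>pJ\<close> is \<alpha>J along
    \<open>\<zeta>\<close>, which is orthogonal to \<open>\<alpha>\<close>, and \<beta>J along
    \<open>\<eta>\<close>, where skewness moves \<open>J\<close> onto \<open>\<alpha>\<close> and
    changes the sign.\<close>
  have \<alpha>J: "c \<alpha> (covec_J (J x) \<alpha>) = 0"
    unfolding c_def using x by (rule cometric_covec_J_self)
  have \<beta>J: "c \<alpha> (covec_J (J x) \<beta>) = - c \<beta> (covec_J (J x) \<alpha>)"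
    unfolding c_def using cometric_covec_J_left[OF x, of \<alpha> \<beta>] cometric_sym[OF x, of \<beta> "covec_J (J x) \<alpha>"]
    by linarith
  \<comment> \<open>The commutator puts \<open>fst \<eta>\<close> into the first slot of the
    curvature; pair symmetry and skewness bring it to the outside, where it tests the horizontal
    equation.\<close>
  have curv: "c (dvpart z \<zeta> \<eta>) (\<alpha> + k *\<^sub>R pJ) - c (dvpart z \<eta> \<zeta>) (\<alpha> + k *\<^sub>R pJ)
      = - g x (curvature g x (sharp (g x) (\<alpha> + k *\<^sub>R pJ)) (sharp (g x) p) (fst \<zeta>)) (fst \<eta>)"
  proof -
    let ?B = "sharp (g x) (\<alpha> + k *\<^sub>R pJ)"
    have "c (dvpart z \<zeta> \<eta>) (\<alpha> + k *\<^sub>R pJ) - c (dvpart z \<eta> \<zeta>) (\<alpha> + k *\<^sub>R pJ)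
        = (dvpart z \<zeta> \<eta> - dvpart z \<eta> \<zeta>) \<bullet> ?B"
      by (simp add: c_simps inner_sharp[OF x] c_def cometric_diff_left[OF x])
    also have "\<dots> = g x (curvature g x (fst \<eta>) (fst \<zeta>) ?B) (sharp (g x) p)"
      by (simp add: dvpart_commutator[OF z] g_sharp'[OF x] flip: x_def p_def)
    also have "\<dots> = g x (curvature g x ?B (sharp (g x) p) (fst \<eta>)) (fst \<zeta>)"
      using x by (rule curvature_pair_sym)
    also have "\<dots> = - g x (curvature g x ?B (sharp (g x) p) (fst \<zeta>)) (fst \<eta>)"
      using curvature_skew[OF x] g_sym[OF x] by metis
    finally show ?thesis .
  qed
  have sym: "c \<beta> p'' = c p'' \<beta>" "c \<alpha> (dvpart z w \<xi>) = c (dvpart z w \<xi>) \<alpha>"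
    "c pJ \<beta> = c \<beta> pJ" for w \<xi>
    unfolding c_def using x by (rule cometric_sym)+
  have gsym: "g x (fst \<zeta>) (christoffel g x (fst \<eta>) (fst \<zeta>)) = g x (christoffel g x (fst \<zeta>) (fst \<eta>)) (fst \<zeta>)"
    "g x (christoffel g x (fst \<eta>) (fst \<zeta>)) (fst \<zeta>) = g x (christoffel g x (fst \<zeta>) (fst \<eta>)) (fst \<zeta>)"
    "g x (fst \<zeta>) (christoffel g x (fst \<zeta>) (fst \<eta>)) = g x (christoffel g x (fst \<zeta>) (fst \<eta>)) (fst \<zeta>)"
    using christoffel_sym[OF x] g_sym[OF x] by metis+
  have bsa: "bs \<delta> z a \<eta> = g x (fst a) (fst \<eta>) + (c (vpart g z a) \<beta> + \<delta>\<^sup>2 * c (vpart g z a) pJ * c \<beta> pJ)"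
    by (simp add: bs_def \<beta>_def c_def pJ_def x_def p_def)
  \<comment> \<open>With equal lower arguments the first two terms of the Koszul formula coincide,
    which gives the Euler-Lagrange form.\<close>
  have "bs \<delta> z (a + christoffel (bs \<delta>) z \<zeta> \<zeta>) \<eta> = bs \<delta> z a \<eta>
      + (cot.dg z \<zeta> \<zeta> \<eta> - cot.dg z \<eta> \<zeta> \<zeta> / 2)"
    by (simp add: cot.g_add_left[OF zU] cot.g_christoffel[OF zU])
  also have "cot.dg z \<zeta> \<zeta> \<eta> = g x (christoffel g x (fst \<zeta>) (fst \<zeta>)) (fst \<eta>)
      + g x (christoffel g x (fst \<zeta>) (fst \<eta>)) (fst \<zeta>)
      + (c (dvpart z \<zeta> \<zeta>) \<beta> + c (dvpart z \<zeta> \<eta>) \<alpha>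
      + \<delta>\<^sup>2 * (c (dvpart z \<zeta> \<zeta>) pJ * c \<beta> pJ + c \<alpha> pJ * (c (dvpart z \<zeta> \<eta>) pJ + c \<beta> (covec_J (J x) \<alpha>))))"
    unfolding cot.dg_def dbs \<alpha>_def[symmetric] \<beta>_def[symmetric] by (simp add: gsym sym \<alpha>J)
  also have "cot.dg z \<eta> \<zeta> \<zeta> / 2 = g x (christoffel g x (fst \<zeta>) (fst \<eta>)) (fst \<zeta>)
      + (c (dvpart z \<eta> \<zeta>) \<alpha> + \<delta>\<^sup>2 * (c \<alpha> pJ * (c (dvpart z \<eta> \<zeta>) pJ - c \<beta> (covec_J (J x) \<alpha>))))"
    unfolding cot.dg_def dbs \<alpha>_def[symmetric] \<beta>_def[symmetric] by (simp add: gsym sym \<beta>J field_simps)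
  \<comment> \<open>Each of the two derivatives contributes one pairing of \<open>\<beta>\<close>
    with \<alpha>J, whence the factor \<open>2 * k\<close>.\<close>
  finally have E: "bs \<delta> z (a + christoffel (bs \<delta>) z \<zeta> \<zeta>) \<eta> = g x x'' (fst \<eta>)
      + (c (dvpart z \<zeta> \<eta>) (\<alpha> + k *\<^sub>R pJ) - c (dvpart z \<eta> \<zeta>) (\<alpha> + k *\<^sub>R pJ))
      + (c p'' \<beta> + \<delta>\<^sup>2 * c p'' pJ * c \<beta> pJ + 2 * k * c \<beta> (covec_J (J x) \<alpha>))"
    unfolding bsa x''_def p''_def k_def c_simps g_add_left[OF x] c_def[symmetric] by (simp add: algebra_simps)
  show ?thesis
    unfolding E curv unfolding g_diff_left[OF x] \<beta>_def[symmetric] c_def[symmetric] c_simps sym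
    by (simp add: algebra_simps)
qed

text \<open>Horizontal and vertical test vectors separate the equation. The vertical part contains
  \<open>p''\<close> twice and is solved by first finding the inner product of \<open>p''\<close>
  with \<open>pJ\<close>.\<close>

lemma geodesic_equation_bs:
  fixes z \<zeta> a :: "'e \<times> 'e" and \<delta> :: real
  assumes z: "fst z \<in> U"
  defines "x \<equiv> fst z" and "p \<equiv> snd z"
  defines "pJ \<equiv> covec_J (J x) p" and "\<alpha> \<equiv> vpart g z \<zeta>"
  defines "b \<equiv> cometric (g x) \<alpha> pJ"
  defines "x'' \<equiv> fst a + christoffel g x (fst \<zeta>) (fst \<zeta>)" and "p'' \<equiv> vpart g z a + dvpart z \<zeta> \<zeta>"
  shows "a + christoffel (bs \<delta>) z \<zeta> \<zeta> = 0 \<longleftrightarrow>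
    x'' = curvature g x (sharp (g x) \<alpha>) (sharp (g x) p) (fst \<zeta>)
        + (\<delta>\<^sup>2 * b) *\<^sub>R curvature g x (sharp (g x) p) (J x (sharp (g x) p)) (fst \<zeta>) \<and>
    p'' = (2 * \<delta>\<^sup>2 * b) *\<^sub>R ((\<delta>\<^sup>2 / (1 + \<delta>\<^sup>2 * cometric (g x) p p) * cometric (g x) \<alpha> p) *\<^sub>R pJ
        - covec_J (J x) \<alpha>)"
proof -
  interpret cot: metric_chart "U \<times> UNIV" "bs \<delta>" by (rule metric_chart_bs)
  have zU: "z \<in> U \<times> UNIV" and x: "x \<in> U" using z by (auto simp: x_def mem_Times_iff)
  define V where "V = sharp (g x) p"
  define \<rho> where "\<rho> = curvature g x (sharp (g x) \<alpha>) V (fst \<zeta>) + (\<delta>\<^sup>2 * b) *\<^sub>R curvature g x V (J x V) (fst \<zeta>)"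
  define c where "c = cometric (g x)"
  define \<epsilon> where "\<epsilon> = p'' + (\<delta>\<^sup>2 * c p'' pJ) *\<^sub>R pJ + (2 * (\<delta>\<^sup>2 * b)) *\<^sub>R covec_J (J x) \<alpha>"
  \<comment> \<open>The sharp of \<open>pJ\<close> is \<open>- J x V\<close>, and antisymmetry
    absorbs the sign by exchanging it with \<open>V\<close>.\<close>
  have \<rho>: "curvature g x (sharp (g x) (\<alpha> + (\<delta>\<^sup>2 * b) *\<^sub>R pJ)) V (fst \<zeta>) = \<rho>"
    using curvature_antisym[OF x, of "J x V" V]
    by (simp add: \<rho>_def V_def pJ_def linear_add[OF linear_sharp[OF x]] linear_scale[OF linear_sharp[OF x]]
        sharp_covec_J[OF x] linear_add[OF linear_curvature_left[OF x]]
        linear_scale[OF linear_curvature_left[OF x]] linear_diff[OF linear_curvature_left[OF x]])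
  have E: "bs \<delta> z (a + christoffel (bs \<delta>) z \<zeta> \<zeta>) \<eta> = g x (x'' - \<rho>) (fst \<eta>) + c (vpart g z \<eta>) \<epsilon>" for \<eta>
    using acceleration_bs[OF z, of \<delta> a \<zeta> \<eta>] \<rho>
    unfolding \<epsilon>_def c_def b_def V_def x''_def p''_def \<alpha>_def pJ_def x_def p_def by simp
  have "a + christoffel (bs \<delta>) z \<zeta> \<zeta> = 0 \<longleftrightarrow> x'' = \<rho> \<and> \<epsilon> = 0"
  proof (intro iffI conjI)
    assume "a + christoffel (bs \<delta>) z \<zeta> \<zeta> = 0"
    then have 0: "g x (x'' - \<rho>) (fst \<eta>) + c (vpart g z \<eta>) \<epsilon> = 0" for \<eta>
      using E[of \<eta>] by (simp add: bilinear_lzero[OF cot.bilinear_g[OF zU]])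
    \<comment> \<open>The test vector is the horizontal lift of \<open>x'' - \<rho>\<close>, whose
      vertical part is 0.\<close>
    show "x'' = \<rho>"
      using 0[of "(x'' - \<rho>, cochr x (x'' - \<rho>) p)"] g_pos[OF x, of "x'' - \<rho>"] cometric_zero_left[OF x]
      by (cases "x'' = \<rho>") (auto simp: c_def vpart_eq x_def p_def)
    \<comment> \<open>The vertical lift of \<open>\<epsilon>\<close> removes the horizontal term and
      leaves the squared norm of \<open>\<epsilon>\<close>.\<close>
    show "\<epsilon> = 0"
      using 0[of "vlift \<epsilon>"] cometric_pos[OF x, of \<epsilon>] bilinear_rzero[OF bilinear_g[OF x]]
      by (cases "\<epsilon> = 0") (auto simp: c_def vlift_def vpart_eq cochr_zero[OF z])
  next
    assume "x'' = \<rho> \<and> \<epsilon> = 0"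
    then show "a + christoffel (bs \<delta>) z \<zeta> \<zeta> = 0"
      by (intro cot.g_eqI[OF zU]) (simp add: E c_def bilinear_lzero[OF bilinear_g[OF x]]
          cometric_zero_right[OF x] bilinear_lzero[OF cot.bilinear_g[OF zU]])
  qed
  moreover have "\<epsilon> = 0 \<longleftrightarrow> p'' = (2 * \<delta>\<^sup>2 * b) *\<^sub>R ((\<delta>\<^sup>2 / (1 + \<delta>\<^sup>2 * c p p) * c \<alpha> p) *\<^sub>R pJ - covec_J (J x) \<alpha>)"
    (is "_ \<longleftrightarrow> p'' = ?r")
  proof -
    define l where "l = 1 + \<delta>\<^sup>2 * c p p"
    have "c p p \<ge> 0"
      using cometric_pos[OF x, of p] cometric_zero_left[OF x, of p] by (cases "p = 0") (auto simp: c_def)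
    then have l: "l > 0" by (simp add: l_def add_pos_nonneg)
    have cJ: "c (covec_J (J x) \<alpha>) pJ = c \<alpha> p" "c pJ pJ = c p p"
      unfolding c_def pJ_def using x by (rule cometric_covec_J_covec_J)+
    note c_simps = cometric_add_left[OF x, folded c_def] cometric_diff_left[OF x, folded c_def]
      cometric_scale_left[OF x, folded c_def] cometric_zero_left[OF x, folded c_def]
    \<comment> \<open>For this \<open>s\<close>, \<open>?r\<close> is the right side of the implicit
      vertical equation with \<open>s\<close> in place of \<open>c p'' pJ\<close>. It remains to
      show that either equation forces this value.\<close>
    have r: "?r = - (\<delta>\<^sup>2 * s) *\<^sub>R pJ - (2 * (\<delta>\<^sup>2 * b)) *\<^sub>R covec_J (J x) \<alpha>"
      if "s = - (2 * \<delta>\<^sup>2 * b) * c \<alpha> p / l" for s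
      unfolding that l_def[symmetric] by (simp add: algebra_simps)
    have "\<epsilon> = p'' - (- (\<delta>\<^sup>2 * c p'' pJ) *\<^sub>R pJ - (2 * (\<delta>\<^sup>2 * b)) *\<^sub>R covec_J (J x) \<alpha>)"
      unfolding \<epsilon>_def by simp
    then have eps: "\<epsilon> = 0 \<longleftrightarrow> p'' = - (\<delta>\<^sup>2 * c p'' pJ) *\<^sub>R pJ - (2 * (\<delta>\<^sup>2 * b)) *\<^sub>R covec_J (J x) \<alpha>"
      by simp
    have "c p'' pJ = - (2 * \<delta>\<^sup>2 * b) * c \<alpha> p / l"
      if "p'' = - (\<delta>\<^sup>2 * c p'' pJ) *\<^sub>R pJ - (2 * (\<delta>\<^sup>2 * b)) *\<^sub>R covec_J (J x) \<alpha>"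
    proof -
      have "\<epsilon> = 0" using that eps by blast
      \<comment> \<open>Pairing with \<open>pJ\<close>, whose squared norm is that of
        \<open>p\<close>, collects the two occurrences of \<open>c p'' pJ\<close> into the factor
        \<open>l\<close>.\<close>
      then have "c \<epsilon> pJ = 0" by (simp add: c_simps)
      then have "c p'' pJ * l = - (2 * \<delta>\<^sup>2 * b) * c \<alpha> p"
        by (simp add: \<epsilon>_def c_simps cJ l_def algebra_simps)
      then show ?thesis using l by (subst nonzero_eq_divide_eq) auto
    qed
    moreover have "c p'' pJ = - (2 * \<delta>\<^sup>2 * b) * c \<alpha> p / l" if "p'' = ?r"
    proof -
      have "c p'' pJ = (2 * \<delta>\<^sup>2 * b) * ((\<delta>\<^sup>2 / l * c \<alpha> p) * c p p - c \<alpha> p)"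
        by (subst that) (simp add: c_simps cJ l_def)
      also have "\<dots> * l = (2 * \<delta>\<^sup>2 * b * c \<alpha> p) * (\<delta>\<^sup>2 * c p p - l)"
        using l by (simp add: field_simps)
      also have "\<dots> = - (2 * \<delta>\<^sup>2 * b) * c \<alpha> p" by (simp add: l_def)
      finally show ?thesis using l by (subst nonzero_eq_divide_eq) auto
    qed
    ultimately show ?thesis
      unfolding eps using r by metis
  qed
  ultimately show ?thesis unfolding \<rho>_def V_def c_def by simp
qed

end

section \<open>From charts to the manifold\<close>

lemma smooth_on_const: "smooth_on (\<lambda>_. c) S"
proof -
  have "ck_on n (\<lambda>_. c) S" for n
    by (induction n arbitrary: c) auto
  then show ?thesis by (simp add: smooth_on_def)
qed

text \<open>Smoothness supplies two derivatives of \<open>g\<close> and one of \<open>J\<close>; on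
  constant fields \<nabla>J = 0 reduces to \<open>J_parallel\<close>.\<close>

lemma kaehler_chart_atlas:
  assumes "standard_kaehler A J g"
  shows "kaehler_chart (chart_im A i) (g i) (J i)"
proof -
  have m: "riemannian_metric A g" and ac: "almost_complex_structure A J" and sa: "smooth_atlas A"
    and iso: "\<And>x u v. x \<in> chart_im A i \<Longrightarrow> g i x (J i x u) (J i x v) = g i x u v"
    and par: "\<And>X Y x. smooth_on X (chart_im A i) \<Longrightarrow> smooth_on Y (chart_im A i) \<Longrightarrow>
      x \<in> chart_im A i \<Longrightarrow> nabla (g i) X (\<lambda>y. J i y (Y y)) x = J i x (nabla (g i) X Y x)"
    using assms by (auto simp: standard_kaehler_def smooth_manifold_def)
  have g_smooth: "smooth_on (\<lambda>x. g i x u v) (chart_im A i)" for u v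
    using m by (simp add: riemannian_metric_def)
  interpret metric_chart "chart_im A i" "g i"
  proof
    \<comment> \<open>The image is that of the overlap of the chart with itself.\<close>
    show "open (chart_im A i)"
      using sa unfolding smooth_atlas_def chart_im_def by (metis Int_absorb)
    show "(\<lambda>y. g i y u v) differentiable (at x)" if "x \<in> chart_im A i" for x u v
      using g_smooth that by (rule smooth_on_differentiable)
  qed (use m in \<open>auto simp: riemannian_metric_def\<close>)
  show ?thesis
  proof (intro kaehler_chart.intro riemannian_chart.intro riemannian_chart_axioms.intro
      kaehler_chart_axioms.intro metric_chart_axioms)
    fix x w u v assume x: "x \<in> chart_im A i"
    show "(\<lambda>y. dg y w u v) differentiable (at x)"
      unfolding dg_def using smooth_on_frechet_derivative[OF g_smooth] x by (rule smooth_on_differentiable)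
    show "linear (J i x)" "J i x (J i x u) = - u"
      using ac x by (auto simp: almost_complex_structure_def)
    show "g i x (J i x u) (J i x v) = g i x u v"
      using x by (rule iso)
    have "smooth_on (\<lambda>y. J i y u) (chart_im A i)"
      using ac by (simp add: almost_complex_structure_def)
    then show "(\<lambda>y. J i y u) differentiable (at x)"
      using x by (rule smooth_on_differentiable)
    show "frechet_derivative (\<lambda>y. J i y v) (at x) u + christoffel (g i) x u (J i x v)
      = J i x (christoffel (g i) x u v)"
      using par[OF smooth_on_const smooth_on_const x, of u v] by (simp add: nabla_def)
  qed
qed

section \<open>Derivatives along curves and the geodesic equation\<close>

lemma has_vector_derivative_has_derivative:
  assumes "(f has_derivative f') (at t)"
  shows "(f has_vector_derivative f' 1) (at t)"
proof -
  have "h *\<^sub>R f' 1 = f' h" for h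
    using linear_scale[OF has_derivative_linear[OF assms], of h 1]
    unfolding real_scaleR_def mult_1_right by (rule sym)
  then have *: "(\<lambda>h. h *\<^sub>R f' 1) = f'" by (rule ext)
  show ?thesis
    unfolding has_vector_derivative_def * by (rule assms)
qed

lemma smooth_on_has_vector_derivative:
  assumes "smooth_on f S" "t \<in> S"
  shows "(f has_vector_derivative vector_derivative f (at t)) (at t)"
  using smooth_on_differentiable[OF assms] by (simp add: vector_derivative_works)

text \<open>\<open>smooth_on\<close> is phrased with Frechet derivatives. They agree with vector
  derivatives on the open set \<open>S\<close>, so the second derivative can be transferred.\<close>

lemma smooth_on_vector_derivative:
  fixes f :: "real \<Rightarrow> 'b::real_normed_vector"
  assumes "smooth_on f S" "open S" "t \<in> S"
  shows "((\<lambda>s. vector_derivative f (at s)) has_vector_derivative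
    vector_derivative (\<lambda>s. vector_derivative f (at s)) (at t)) (at t)"
proof -
  have eq: "frechet_derivative f (at s) 1 = vector_derivative f (at s)" if "s \<in> S" for s
    using frechet_derivative_eq_vector_derivative[OF smooth_on_differentiable[OF assms(1) that]] by simp
  have "((\<lambda>s. vector_derivative f (at s)) has_vector_derivative
      vector_derivative (\<lambda>s. frechet_derivative f (at s) 1) (at t)) (at t)"
    using smooth_on_has_vector_derivative[OF smooth_on_frechet_derivative[OF assms(1)] assms(3)]
    by (rule has_vector_derivative_transform_within_open[OF _ assms(2,3)]) (rule eq)
  then show ?thesis by (simp add: vector_derivative_at)
qed

lemma berger_sasaki_eq_bs:
  "kaehler_chart U (g i) (J i) \<Longrightarrow> berger_sasaki \<delta> J g i = kaehler_chart.bs (g i) (J i) \<delta>"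
  by (rule ext)+ (simp only: berger_sasaki_def kaehler_chart.bs_def Let_def case_prod_unfold prod.collapse)

text \<open>For the coordinate curve \<open>z\<close>, the vertical part of the velocity
  \<open>\<zeta>\<close> is \<vartheta>', and that of \<open>a\<close> plus \<open>dvpart\<close> is
  \<vartheta>''. The claim is then \<open>geodesic_equation_bs\<close> at
  \<open>z t\<close>.\<close>

lemma covd_vec_velocity_berger_sasaki:
  fixes A :: "('i, 'a, 'e::euclidean_space) atlas" and \<delta> :: real
  assumes K: "standard_kaehler A J g"
    and c: "smooth_curve (cotangent A) I (\<lambda>t. (\<gamma> t, \<theta> t))"
    and t: "t \<in> I" "\<gamma> t \<in> chart_dom A i"
  defines "x \<equiv> chart_map A i (\<gamma> t)" and "p \<equiv> \<theta> t i"
    and "p' \<equiv> covd_covec A g \<gamma> \<theta> t i" and "v \<equiv> velocity A \<gamma> t i"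
  defines "G \<equiv> g i x" and "Jx \<equiv> J i x"
  defines "b \<equiv> \<delta>\<^sup>2 * cometric G p' (covec_J Jx p)"
  shows "covd_vec (cotangent A) (berger_sasaki \<delta> J g) (\<lambda>t. (\<gamma> t, \<theta> t))
      (velocity (cotangent A) (\<lambda>t. (\<gamma> t, \<theta> t))) t i = 0 \<longleftrightarrow>
    covd_vec A g \<gamma> (velocity A \<gamma>) t i =
        curvature (g i) x (sharp G p') (sharp G p) v
        + b *\<^sub>R curvature (g i) x (sharp G p) (Jx (sharp G p)) v \<and>
    covd_covec A g \<gamma> (covd_covec A g \<gamma> \<theta>) t i =
        (2 * b) *\<^sub>R ((\<delta>\<^sup>2 / (1 + \<delta>\<^sup>2 * cometric G p p) * cometric G p' p) *\<^sub>R covec_J Jx p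
          - covec_J Jx p')"
proof -
  interpret kaehler_chart "chart_im A i" "g i" "J i"
    using K by (rule kaehler_chart_atlas)
  define T where "T = {s \<in> I. \<gamma> s \<in> chart_dom A i}"
  define z where "z s = (chart_map A i (\<gamma> s), \<theta> s i)" for s
  define \<zeta> where "\<zeta> s = vector_derivative z (at s)" for s
  define a where "a = vector_derivative \<zeta> (at t)"
  \<comment> \<open>Points of the curve lie in the bundle, so being in a bundle chart depends on the
    base point alone.\<close>
  have "covector_at A (\<gamma> s) (\<theta> s)" if "s \<in> I" for s
    using c that by (auto simp: smooth_curve_def points_def cotangent_def chart_dom_def)
  then have T: "{s \<in> I. (\<gamma> s, \<theta> s) \<in> chart_dom (cotangent A) i} = T"
    by (auto simp: T_def cotangent_def chart_dom_def)
  have z: "(\<lambda>s. chart_map (cotangent A) i (\<gamma> s, \<theta> s)) = z"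
    by (simp add: z_def cotangent_def chart_map_def fun_eq_iff)
  have "open T" and zs: "smooth_on z T"
    using c T z by (auto simp: smooth_curve_def)
  have tT: "t \<in> T" using t by (simp add: T_def)
  have xU: "fst (z s) \<in> chart_im A i" if "s \<in> T" for s
    using that by (auto simp: T_def z_def chart_im_def)
  have dz: "(z has_vector_derivative \<zeta> s) (at s)" if "s \<in> T" for s
    using zs that unfolding \<zeta>_def by (rule smooth_on_has_vector_derivative)
  have d\<zeta>: "(\<zeta> has_vector_derivative a) (at t)"
    using smooth_on_vector_derivative[OF zs \<open>open T\<close> tT] by (simp add: \<zeta>_def[abs_def] a_def)
  have fst: "((\<lambda>s. fst (f s)) has_vector_derivative fst f') (at s)"
    and snd: "((\<lambda>s. snd (f s)) has_vector_derivative snd f') (at s)"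
    if "(f has_vector_derivative f') (at s)" for f :: "real \<Rightarrow> 'e \<times> 'e" and f' s
    using has_derivative_fst[OF that[unfolded has_vector_derivative_def]]
      has_derivative_snd[OF that[unfolded has_vector_derivative_def]]
    by (auto simp: has_vector_derivative_def)
  have v: "velocity A \<gamma> s i = fst (\<zeta> s)" if "s \<in> T" for s
    using vector_derivative_at[OF fst[OF dz[OF that]]] by (simp add: velocity_def z_def)
  have dv: "vector_derivative (\<lambda>s. velocity A \<gamma> s i) (at t) = fst a"
    by (rule vector_derivative_at, rule has_vector_derivative_transform_within_open[OF fst[OF d\<zeta>] \<open>open T\<close> tT])
      (simp add: v)
  \<comment> \<open>\<open>covd_covec\<close> has the velocity in the first Christoffel slot,
    \<open>cochr\<close> in the second.\<close>
  have cochr_eq: "covec (\<lambda>v. \<omega> \<bullet> christoffel (g i) (fst (z s)) u v) = cochr (fst (z s)) u \<omega>"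
    if "s \<in> T" for s u \<omega>
    by (simp add: cochr_def christoffel_sym[OF xU[OF that], of u])
  have D: "covd_covec A g \<gamma> \<theta> s i = vpart (g i) (z s) (\<zeta> s)" if "s \<in> T" for s
    using vector_derivative_at[OF snd[OF dz[OF that]]] cochr_eq[OF that]
    by (simp add: covd_covec_def vpart_eq v[OF that] z_def)
  have "((\<lambda>s. vpart (g i) (z s) (\<zeta> s)) has_vector_derivative
    vpart (g i) (z t) a + dvpart (z t) (\<zeta> t) (\<zeta> t) + cochr (fst (z t)) (fst (\<zeta> t)) (vpart (g i) (z t) (\<zeta> t))) (at t)"
    using has_vector_derivative_has_derivative[OF has_derivative_vpart[OF xU[OF tT]
        dz[OF tT, unfolded has_vector_derivative_def] d\<zeta>[unfolded has_vector_derivative_def]]]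
    by simp
  then have "vector_derivative (\<lambda>s. covd_covec A g \<gamma> \<theta> s i) (at t) =
    vpart (g i) (z t) a + dvpart (z t) (\<zeta> t) (\<zeta> t) + cochr (fst (z t)) (fst (\<zeta> t)) (vpart (g i) (z t) (\<zeta> t))"
    by (rule vector_derivative_at[OF has_vector_derivative_transform_within_open[OF _ \<open>open T\<close> tT]])
      (simp add: D)
  \<comment> \<open>The connection term of the second covariant derivative cancels the
    \<open>cochr\<close> term of the ordinary derivative.\<close>
  then have p'': "covd_covec A g \<gamma> (covd_covec A g \<gamma> \<theta>) t i = vpart (g i) (z t) a + dvpart (z t) (\<zeta> t) (\<zeta> t)"
    using cochr_eq[OF tT] by (simp add: covd_covec_def[of A g \<gamma> "covd_covec A g \<gamma> \<theta>"] D[OF tT] v[OF tT] z_def)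
  have x'': "covd_vec A g \<gamma> (velocity A \<gamma>) t i
      = fst a + christoffel (g i) (fst (z t)) (fst (\<zeta> t)) (fst (\<zeta> t))"
    by (simp add: covd_vec_def dv v[OF tT] z_def)
  have L: "covd_vec (cotangent A) (berger_sasaki \<delta> J g) (\<lambda>t. (\<gamma> t, \<theta> t))
      (velocity (cotangent A) (\<lambda>t. (\<gamma> t, \<theta> t))) t i = a + christoffel (bs \<delta>) (z t) (\<zeta> t) (\<zeta> t)"
    unfolding covd_vec_def velocity_def z fun_cong[OF z] a_def \<zeta>_def[abs_def]
      berger_sasaki_eq_bs[of "chart_im A i" g i J, OF kaehler_chart_axioms] ..
  have zt: "fst (z t) = chart_map A i (\<gamma> t)" "snd (z t) = \<theta> t i"
    by (simp_all add: z_def)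
  show ?thesis
    using geodesic_equation_bs[OF xU[OF tT], of a \<delta> "\<zeta> t"]
    unfolding L p'' x'' x_def p_def p'_def v_def G_def Jx_def b_def D[OF tT] v[OF tT]
    by (simp only: zt mult.assoc)
qed

theorem theorem5p2:
  fixes A :: "('i, 'a, 'e::euclidean_space) atlas"
    and J :: "'i \<Rightarrow> 'e \<Rightarrow> 'e \<Rightarrow> 'e" and g :: "('i, 'e) metric"
    and m :: nat and \<delta> :: real
    and I :: "real set" and \<gamma> :: "real \<Rightarrow> 'a" and \<theta> :: "real \<Rightarrow> 'i \<Rightarrow> 'e"
  assumes "DIM('e) = 2 * m"
    and "standard_kaehler A J g"
    and "open I" and "is_interval I"
    and "smooth_curve (cotangent A) I (\<lambda>t. (\<gamma> t, \<theta> t))"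
  shows "geodesic (cotangent A) (berger_sasaki \<delta> J g) I (\<lambda>t. (\<gamma> t, \<theta> t)) \<longleftrightarrow>
    (\<forall>t\<in>I. \<forall>i. \<gamma> t \<in> chart_dom A i \<longrightarrow>
      (let x = chart_map A i (\<gamma> t);
           R = curvature (g i) x;
           Jx = J i x;
           ginv = cometric (g i x);
           tilde = sharp (g i x);
           \<gamma>' = velocity A \<gamma> t i;
           \<gamma>'' = covd_vec A g \<gamma> (velocity A \<gamma>) t i;
           th = \<theta> t i;
           th' = covd_covec A g \<gamma> \<theta> t i;
           th'' = covd_covec A g \<gamma> (covd_covec A g \<gamma> \<theta>) t i;
           lam = 1 + \<delta>\<^sup>2 * ginv th th
       in \<gamma>'' = R (tilde th') (tilde th) \<gamma>'
               + (\<delta>\<^sup>2 * ginv th' (covec_J Jx th)) *\<^sub>R R (tilde th) (Jx (tilde th)) \<gamma>' \<and>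
          th'' = (2 * \<delta>\<^sup>2 * ginv th' (covec_J Jx th)) *\<^sub>R
                   ((\<delta>\<^sup>2 / lam * ginv th' th) *\<^sub>R covec_J Jx th - covec_J Jx th')))"
proof -
  \<comment> \<open>Bundle charts and base charts contain the same parameters, so both sides
    quantify over the same charts and compare pointwise.\<close>
  have "(\<gamma> t, \<theta> t) \<in> chart_dom (cotangent A) i \<longleftrightarrow> \<gamma> t \<in> chart_dom A i" if "t \<in> I" for t i
    using assms(5) that by (auto simp: smooth_curve_def points_def cotangent_def chart_dom_def)
  then show ?thesis
    using assms(5) by (simp add: geodesic_def Let_def covd_vec_velocity_berger_sasaki[OF assms(2,5)] mult.assoc)
qed

end
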